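(* Up to equivalence, $K_5$ has $14$ orientable and $17$ non-orientable 2-cell embeddings on the double torus.
   Context: The double torus is the orientable surface of genus 2. A 2-cell embedding (every face homeomorphic to an open disc) is described by a rotation system (for each vertex, a cyclic ordering of its incident edges). Two embeddings are isomorphic if a permutation of vertices and edges (preserving incidence) transforms one rotation system into the other. An embedding and the embedding obtained by reversing all its rotations are considered equivalent. An embedding is non-orientable if its reversal is isomorphic to it, and orientable otherwise. *)

theory Defs
  imports "HOL-Library.Ramsey" "HOL-Combinatorics.Orbits"
begin

text \<open>A simple graph is given by a vertex set \<open>V\<close> and a set \<open>E\<close> of two-element subsets of \<open>V\<close>.\<close>

definition connected_simple_graph :: "'v set \<Rightarrow> 'v set set \<Rightarrow> bool" where
  "connected_simple_graph V E \<longleftrightarrow>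
     finite V \<and> V \<noteq> {} \<and> E \<subseteq> nsets V 2 \<and>
     (\<forall>u\<in>V. \<forall>v\<in>V. (u, v) \<in> {(x, y). {x, y} \<in> E}\<^sup>*)"

definition K5_vertices :: "nat set" where
  "K5_vertices = {1..5}"

definition K5_edges :: "nat set set" where
  "K5_edges = nsets K5_vertices 2"

definition incident_edges :: "'v set set \<Rightarrow> 'v \<Rightarrow> 'v set set" where
  "incident_edges E v = {e \<in> E. v \<in> e}"

text \<open>A rotation system \<open>\<rho>\<close> sends a vertex \<open>v\<close> and an edge \<open>e\<close> at \<open>v\<close> to the edge \<open>\<rho> v e\<close>
  following \<open>e\<close> in the cyclic ordering at \<open>v\<close>. The values that carry no information are fixed to
  be the identity, so that distinct functions are distinct rotation systems. Since
  \<open>cyclic_on\<close> fails on the empty set, graphs with isolated vertices have no rotation system here.\<close>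

type_synonym 'v rotation = "'v \<Rightarrow> 'v set \<Rightarrow> 'v set"

definition rotation_system :: "'v set \<Rightarrow> 'v set set \<Rightarrow> 'v rotation \<Rightarrow> bool" where
  "rotation_system V E \<rho> \<longleftrightarrow>
     (\<forall>v\<in>V. \<rho> v permutes incident_edges E v \<and> cyclic_on (\<rho> v) (incident_edges E v)) \<and>
     (\<forall>v. v \<notin> V \<longrightarrow> \<rho> v = id)"

text \<open>A dart \<open>(v, e)\<close> is the edge \<open>e\<close> traversed starting at its end \<open>v\<close>.\<close>

definition darts :: "'v set \<Rightarrow> 'v set set \<Rightarrow> ('v \<times> 'v set) set" where
  "darts V E = {(v, e). v \<in> V \<and> e \<in> incident_edges E v}"

definition other_end :: "'v set \<Rightarrow> 'v \<Rightarrow> 'v" where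
  "other_end e v = (THE w. w \<in> e \<and> w \<noteq> v)"

text \<open>Face tracing: walk along \<open>e\<close> from \<open>v\<close> to its other end and leave along the edge that
  follows \<open>e\<close> in the rotation there. The facial walks are the orbits on darts.\<close>

definition face_step :: "'v rotation \<Rightarrow> 'v \<times> 'v set \<Rightarrow> 'v \<times> 'v set" where
  "face_step \<rho> = (\<lambda>(v, e). (other_end e v, \<rho> (other_end e v) e))"

definition faces :: "'v set \<Rightarrow> 'v set set \<Rightarrow> 'v rotation \<Rightarrow> ('v \<times> 'v set) set set" where
  "faces V E \<rho> = orbit (face_step \<rho>) ` darts V E"

definition euler_characteristic :: "'v set \<Rightarrow> 'v set set \<Rightarrow> 'v rotation \<Rightarrow> int" where
  "euler_characteristic V E \<rho> = int (card V) - int (card E) + int (card (faces V E \<rho>))"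

text \<open>The 2-cell embeddings of a connected graph on the orientable surface of genus \<open>g\<close>:
  gluing a disc along every facial walk yields a closed connected orientable surface, whose genus
  is determined by its Euler characteristic \<open>2 - 2g\<close>.\<close>

definition two_cell_embeddings :: "nat \<Rightarrow> 'v set \<Rightarrow> 'v set set \<Rightarrow> 'v rotation set" where
  "two_cell_embeddings g V E =
     {\<rho>. connected_simple_graph V E \<and> rotation_system V E \<rho> \<and>
         euler_characteristic V E \<rho> = 2 - 2 * int g}"

abbreviation double_torus_embeddings :: "'v set \<Rightarrow> 'v set set \<Rightarrow> 'v rotation set" where
  "double_torus_embeddings \<equiv> two_cell_embeddings 2"

definition isomorphic_embeddings ::
    "'v set \<Rightarrow> 'v set set \<Rightarrow> 'v rotation \<Rightarrow> 'v rotation \<Rightarrow> bool" where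
  "isomorphic_embeddings V E \<rho> \<rho>' \<longleftrightarrow>
     (\<exists>\<sigma> \<tau>. \<sigma> permutes V \<and> \<tau> permutes E \<and>
        (\<forall>v\<in>V. \<forall>e\<in>E. v \<in> e \<longleftrightarrow> \<sigma> v \<in> \<tau> e) \<and>
        (\<forall>v\<in>V. \<forall>e\<in>incident_edges E v. \<rho>' (\<sigma> v) (\<tau> e) = \<tau> (\<rho> v e)))"

definition reversal :: "'v rotation \<Rightarrow> 'v rotation" where
  "reversal \<rho> = (\<lambda>v. inv (\<rho> v))"

text \<open>In the next definitions ``orientable'' is a property of the embedding, not of the surface:
  an embedding is non-orientable if it is isomorphic to its mirror image.\<close>

definition nonorientable_embedding :: "'v set \<Rightarrow> 'v set set \<Rightarrow> 'v rotation \<Rightarrow> bool" where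
  "nonorientable_embedding V E \<rho> \<longleftrightarrow> isomorphic_embeddings V E (reversal \<rho>) \<rho>"

definition orientable_embedding :: "'v set \<Rightarrow> 'v set set \<Rightarrow> 'v rotation \<Rightarrow> bool" where
  "orientable_embedding V E \<rho> \<longleftrightarrow> \<not> nonorientable_embedding V E \<rho>"

definition embedding_equivalence ::
    "nat \<Rightarrow> 'v set \<Rightarrow> 'v set set \<Rightarrow> ('v rotation \<times> 'v rotation) set" where
  "embedding_equivalence g V E =
     {(\<rho>, \<rho>'). \<rho> \<in> two_cell_embeddings g V E \<and> \<rho>' \<in> two_cell_embeddings g V E \<and>
        (isomorphic_embeddings V E \<rho> \<rho>' \<or> isomorphic_embeddings V E (reversal \<rho>) \<rho>')}"

end

theory Submission
  imports Defs "HOL-Library.Product_Lexorder"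
begin

text \<open>Normalise a rotation of \<open>K\<^sub>5\<close> at a starting dart \<open>(v, w)\<close>: rename \<open>v\<close> to \<open>V1\<close> and the neighbours of
  \<open>v\<close>, in cyclic order from \<open>w\<close>, to \<open>V2, V3, V4, V5\<close>. An isomorphism that fixes the starting dart is
  then the identity, so the at most 20 normal forms of a rotation determine its isomorphism class,
  and with those of the mirror image they determine its equivalence class. Hence the classes
  correspond to the codes that are least among their own normal forms and those of their mirror
  images. These least codes are found among the \<open>6\<^sup>4\<close> normal forms by computation, together with
  their numbers of faces; genus 2 means three faces, since \<open>5 - 10 + 3 = -2\<close>.\<close>

section \<open>Orbits\<close>

text \<open>Completeness of the graph is what makes the normal forms rigid: the ordering at one
  vertex already lists all the other vertices, so a vertex and one neighbour name everything. What
  stays free is the ordering at four vertices, and each has 3! = 6 choices once its known entry is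
  put first. The obstacle is that embeddings are functions on sets of edges and that isomorphism
  quantifies over pairs of permutations. Two reductions make this computable. An edge at a vertex is
  replaced by its other end, which turns a rotation system into one permutation of the remaining
  vertices at each vertex and absorbs the edge permutation into the vertex permutation. The search
  for an isomorphism is replaced by explicit renormalisations, one for each dart. For the count on
  representatives to be correct, the number of faces and the property of being isomorphic to the
  mirror image must be constant on equivalence classes. The first rests on conjugating the face
  permutations, the second on composing isomorphisms.\<close>

lemma orbit_semiconj:
  assumes "x \<in> S" and closed: "\<And>y. y \<in> S \<Longrightarrow> f y \<in> S"
    and comm: "\<And>y. y \<in> S \<Longrightarrow> f' (g y) = g (f y)"
  shows "orbit f' (g x) = g ` orbit f x"
proof -
  have sub: "y \<in> S" if "y \<in> orbit f x" for y
    using that by induct (use assms in auto)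
  show ?thesis
  proof (intro equalityI subsetI)
    fix z assume "z \<in> orbit f' (g x)"
    then show "z \<in> g ` orbit f x"
    proof induct
      case base
      then show ?case using comm[OF \<open>x \<in> S\<close>] by (auto intro: orbit.base)
    next
      case (step y)
      then show ?case using comm sub by (auto intro: orbit.step)
    qed
  next
    fix z assume "z \<in> g ` orbit f x"
    then obtain y where "y \<in> orbit f x" "z = g y" by blast
    then show "z \<in> orbit f' (g x)"
    proof (induct arbitrary: z)
      case base
      then show ?case using comm[OF \<open>x \<in> S\<close>] orbit.base[of f' "g x"] by simp
    next
      case (step y)
      then show ?case using comm sub orbit.step[of "g y" f' "g x"] by simp
    qed
  qed
qed

text \<open>Serves three comparisons of face numbers: under relabelling, under mirroring, and
  between edge darts and pairs of vertices. The commutation is asked for on \<open>S\<close> only,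
  because in the last comparison it is available just for pairs of distinct vertices.\<close>

lemma card_orbits_semiconj:
  assumes closed: "\<And>y. y \<in> S \<Longrightarrow> f y \<in> S"
    and comm: "\<And>y. y \<in> S \<Longrightarrow> f' (g y) = g (f y)" and inj: "inj_on g S"
  shows "card (orbit f' ` g ` S) = card (orbit f ` S)"
proof -
  have "y \<in> S" if "y \<in> orbit f x" "x \<in> S" for x y
    using that by induct (use closed in auto)
  then have "inj_on ((`) g) (orbit f ` S)"
    using inj by (intro inj_onI) (auto simp: inj_on_image_eq_iff subset_eq dest!: inj_on_image_eq_iff[THEN iffD1, rotated 3])
  moreover have "orbit f' ` g ` S = (`) g ` (orbit f ` S)"
    using orbit_semiconj[of _ S f f' g] closed comm by (force simp: image_image intro!: image_cong)
  ultimately show ?thesis by (simp add: card_image)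
qed

text \<open>Conjugation by \<open>h\<close>, extended by the identity outside \<open>B\<close>. It
  is applied in both directions between the neighbours of a vertex and the edges there.\<close>

lemma transport_cyclic_permutation:
  assumes "p permutes A" "cyclic_on p A" "bij_betw h A B"
  obtains q where "q permutes B" "cyclic_on q B" "\<And>x. x \<in> A \<Longrightarrow> q (h x) = h (p x)"
proof
  let ?q = "\<lambda>x. if x \<in> B then h (p (inv_into A h x)) else x"
  show "?q permutes B" using assms(1,3) by (rule permutes_bij_inv_into)
  show comm: "?q (h x) = h (p x)" if "x \<in> A" for x
    using that assms(3) by (auto simp: bij_betw_def)
  have "h ` A = B" using assms(3) by (auto simp: bij_betw_def)
  with cyclic_on_image[OF assms(2), of ?q h] comm show "cyclic_on ?q B" by simp
qed

text \<open>A certificate that is cheap to check. Each list is a cycle of \<open>f\<close>; the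
  lists cover \<open>D\<close>, and their total length leaves no room for repetitions when
  \<open>D\<close> is distinct, so disjointness follows by counting instead of being tested. Empty
  lists are excluded since they would be counted as cycles.\<close>

definition cycle_decomposition :: "('a \<Rightarrow> 'a) \<Rightarrow> 'a list \<Rightarrow> 'a list list \<Rightarrow> bool" where
  "cycle_decomposition f D Ws \<longleftrightarrow>
     list_all (\<lambda>w. w \<noteq> [] \<and> map f w = rotate1 w) Ws \<and>
     list_all (\<lambda>d. d \<in> set (concat Ws)) D \<and> length (concat Ws) = length D"

lemma orbit_rotate1:
  assumes "map f w = rotate1 w" "x \<in> set w"
  shows "orbit f x = set w"
proof -
  have n: "f (w ! i) = w ! (Suc i mod length w)" if "i < length w" for i
    using that assms(1) by (metis length_map nth_map nth_rotate1)
  obtain i where i: "i < length w" "w ! i = x" using assms(2) by (auto simp: in_set_conv_nth)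
  have pw: "(f ^^ k) x = w ! ((i + k) mod length w)" for k
  proof (induct k)
    case (Suc k)
    have "(i + k) mod length w < length w" using i by (auto intro: mod_less_divisor)
    then show ?case using Suc n[of "(i + k) mod length w"] by (simp add: mod_Suc_eq)
  qed (use i in simp)
  show ?thesis
  proof (intro equalityI subsetI)
    fix y assume "y \<in> orbit f x"
    then show "y \<in> set w" using i by (auto simp: orbit_altdef pw intro!: nth_mem mod_less_divisor)
  next
    fix y assume "y \<in> set w"
    then obtain j where j: "j < length w" "w ! j = y" by (auto simp: in_set_conv_nth)
    \<comment> \<open>Going once around the list keeps the exponent positive even for
      \<open>j\<close> at most \<open>i\<close>; an orbit consists of positive iterates
      only.\<close>
    have "(f ^^ (j + length w - i)) x = y" "0 < j + length w - i"
      using i j by (auto simp: pw)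
    then show "y \<in> orbit f x" unfolding orbit_altdef by blast
  qed
qed

lemma card_orbits_cycle_decomposition:
  assumes "cycle_decomposition f D Ws" "distinct D"
  shows "card (orbit f ` set D) = length Ws"
proof -
  have W: "w \<noteq> []" "map f w = rotate1 w" if "w \<in> set Ws" for w
    using assms(1) that by (auto simp: cycle_decomposition_def list_all_iff)
  have sub: "set D \<subseteq> set (concat Ws)" and len: "length (concat Ws) = length D"
    using assms(1) by (auto simp: cycle_decomposition_def list_all_iff)
  have "card (set (concat Ws)) \<le> card (set D)"
    using len card_length[of "concat Ws"] distinct_card[OF assms(2)] by simp
  then have eq: "set D = set (concat Ws)" using sub by (intro card_seteq) auto
  then have dist: "distinct (concat Ws)"
    using len distinct_card[OF assms(2)] by (intro card_distinct) simp
  have "orbit f ` set D = set ` set Ws"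
  proof (intro equalityI subsetI)
    fix X assume "X \<in> orbit f ` set D"
    then show "X \<in> set ` set Ws" using orbit_rotate1 W eq by fastforce
  next
    fix X assume "X \<in> set ` set Ws"
    then obtain w where w: "w \<in> set Ws" "X = set w" by blast
    then have "hd w \<in> set D" "orbit f (hd w) = X"
      using W eq orbit_rotate1[of f w "hd w"] by auto
    then show "X \<in> orbit f ` set D" by blast
  qed
  moreover have "inj_on set (set Ws)"
  proof (rule inj_onI)
    fix w w' assume *: "w \<in> set Ws" "w' \<in> set Ws" "set w = set w'"
    show "w = w'"
    proof (rule ccontr)
      assume "w \<noteq> w'"
      then have "set w \<inter> set w' = {}"
        using dist * unfolding distinct_concat_iff by blast
      then show False using * W by auto
    qed
  qed
  moreover have "distinct Ws"
  proof -
    have "[] \<notin> set Ws" using W by blast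
    then show ?thesis using dist by (simp add: distinct_concat_iff)
  qed
  ultimately show ?thesis by (simp add: card_image distinct_card)
qed

text \<open>No correctness proof is needed for the traced cycles, since \<open>cycle_decomposition\<close> checks them.\<close>

function trace_cycles :: "('a \<Rightarrow> 'a) \<Rightarrow> 'a list \<Rightarrow> 'a list \<Rightarrow> 'a \<Rightarrow> 'a list list" where
  "trace_cycles f L w x =
     (if x \<in> set L then trace_cycles f (remove1 x L) (w @ [x]) (f x)
      else w # (case L of [] \<Rightarrow> [] | y # L' \<Rightarrow> trace_cycles f L' [y] (f y)))"
  by auto
termination
  by (relation "measure (\<lambda>(f, L, w, x). length L)")
    (auto simp: length_remove1 dest: length_pos_if_in_set)

declare trace_cycles.simps [simp del]

text \<open>Reflexivity on \<open>A\<close> is obtained from symmetry and transitivity, by going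
  from \<open>x\<close> to its representative and back. Hence \<open>A\<close> may be just a part of
  the domain of \<open>E\<close>, as in the separate counts of orientable and non-orientable
  embeddings.\<close>

lemma card_quotient_representatives:
  assumes "sym E" "trans E"
    and "\<And>m. m \<in> M \<Longrightarrow> h m \<in> A"
    and "\<And>x. x \<in> A \<Longrightarrow> \<exists>m\<in>M. (x, h m) \<in> E"
    and "\<And>m m'. m \<in> M \<Longrightarrow> m' \<in> M \<Longrightarrow> (h m, h m') \<in> E \<Longrightarrow> m = m'"
  shows "card (A // E) = card M"
proof -
  have class_eq: "E `` {x} = E `` {y}" if "(x, y) \<in> E" for x y
    using that assms(1,2) by (auto dest: symD transD)
  have refl: "(x, x) \<in> E" if "x \<in> A" for x
    using assms(4)[OF that] assms(1,2) by (meson symD transD)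
  have "A // E = (\<lambda>m. E `` {h m}) ` M"
  proof (intro equalityI subsetI)
    fix X assume "X \<in> A // E"
    then obtain x where "x \<in> A" "X = E `` {x}" by (auto simp: quotient_def)
    then show "X \<in> (\<lambda>m. E `` {h m}) ` M" using assms(4) class_eq by blast
  qed (use assms(3) in \<open>auto simp: quotient_def\<close>)
  moreover have "inj_on (\<lambda>m. E `` {h m}) M"
  proof (rule inj_onI)
    fix m m' assume *: "m \<in> M" "m' \<in> M" "E `` {h m} = E `` {h m'}"
    then have "(h m, h m') \<in> E" using refl[OF assms(3)[OF *(2)]] by auto
    with assms(5) * show "m = m'" by blast
  qed
  ultimately show ?thesis by (simp add: card_image)
qed

section \<open>Rotations of the complete graph on five labelled vertices\<close>

text \<open>With a type of exactly five elements, vertex permutations are bijections of the type,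
  neighbourhoods are complements \<open>- {v}\<close>, and evaluation works on constructors.\<close>

datatype vertex = V1 | V2 | V3 | V4 | V5

lemma UNIV_vertex: "UNIV = {V1, V2, V3, V4, V5}"
  using vertex.exhaust by blast

instance vertex :: finite
  by standard (simp add: UNIV_vertex)

lemma card_UNIV_vertex: "card (UNIV :: vertex set) = 5"
  by (simp add: UNIV_vertex)

lemma UNIV_vertex_distinct:
  assumes "distinct [v, w, x, y, z :: vertex]"
  shows "UNIV = {v, w, x, y, z}"
proof -
  have "card {v, w, x, y, z} = 5" using assms by simp
  then have "card {v, w, x, y, z} = card (UNIV :: vertex set)" by (simp add: card_UNIV_vertex)
  then show ?thesis using card_subset_eq[of UNIV "{v, w, x, y, z}"] by (metis finite subset_UNIV)
qed

fun label :: "vertex \<Rightarrow> nat" where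
  "label V1 = 1"
| "label V2 = 2"
| "label V3 = 3"
| "label V4 = 4"
| "label V5 = 5"

lemma label_inject [simp]: "label v = label w \<longleftrightarrow> v = w"
  by (cases v; cases w) simp_all

instantiation vertex :: linorder
begin

definition "v \<le> w \<longleftrightarrow> label v \<le> label w"

definition "v < w \<longleftrightarrow> label v < label w"

instance
  by standard (auto simp: less_eq_vertex_def less_vertex_def)

end

text \<open>Comparison by cases on constructors keeps numerals out of the evaluation.\<close>

lemma less_vertex_code [code]:
  "V1 < w \<longleftrightarrow> w \<noteq> V1"
  "V2 < w \<longleftrightarrow> w \<noteq> V1 \<and> w \<noteq> V2"
  "V3 < w \<longleftrightarrow> w = V4 \<or> w = V5"
  "V4 < w \<longleftrightarrow> w = V5"
  "V5 < w \<longleftrightarrow> False"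
  by (cases w; simp add: less_vertex_def)+

lemma less_eq_vertex_code [code]: "v \<le> w \<longleftrightarrow> v = w \<or> v < (w :: vertex)"
  by (auto simp: less_eq_vertex_def less_vertex_def)

text \<open>\<open>R v w\<close> is the neighbour that follows \<open>w\<close> in the cyclic ordering at \<open>v\<close>.\<close>

definition rotation :: "(vertex \<Rightarrow> vertex \<Rightarrow> vertex) \<Rightarrow> bool" where
  "rotation R \<longleftrightarrow> (\<forall>v. R v permutes - {v} \<and> cyclic_on (R v) (- {v}))"

text \<open>One map suffices, because in a simple graph an edge is determined by its ends. The
  equation can range over all pairs: for rotations, both sides equal \<open>\<sigma> v\<close> when
  \<open>v = w\<close>.\<close>

definition rotation_iso ::
    "(vertex \<Rightarrow> vertex \<Rightarrow> vertex) \<Rightarrow> (vertex \<Rightarrow> vertex \<Rightarrow> vertex) \<Rightarrow> (vertex \<Rightarrow> vertex) \<Rightarrow> bool" where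
  "rotation_iso R R' \<sigma> \<longleftrightarrow> bij \<sigma> \<and> (\<forall>v w. R' (\<sigma> v) (\<sigma> w) = \<sigma> (R v w))"

definition mirror_rotation :: "(vertex \<Rightarrow> vertex \<Rightarrow> vertex) \<Rightarrow> vertex \<Rightarrow> vertex \<Rightarrow> vertex" where
  "mirror_rotation R v = inv (R v)"

lemma rotation_permutes: "rotation R \<Longrightarrow> R v permutes - {v}"
  by (simp add: rotation_def)

lemma rotation_bij: "rotation R \<Longrightarrow> bij (R v)"
  using rotation_permutes permutes_bij by blast

lemma rotation_self [simp]: "rotation R \<Longrightarrow> R v v = v"
  using rotation_permutes[of R v] by (simp add: permutes_not_in)

lemma rotation_neq: "rotation R \<Longrightarrow> w \<noteq> v \<Longrightarrow> R v w \<noteq> v"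
  using rotation_permutes[of R v] permutes_in_image[of "R v" "- {v}" w] by simp

lemma rotation_mirror:
  assumes "rotation R"
  shows "rotation (mirror_rotation R)"
  unfolding rotation_def mirror_rotation_def
proof (intro allI conjI)
  fix v
  have p: "R v permutes - {v}" using assms by (rule rotation_permutes)
  then show "inv (R v) permutes - {v}" by (rule permutes_inv)
  have "permutation (R v)" using p finite permutation_permutes by blast
  then have "orbit (inv (R v)) = orbit (R v)" by (simp add: fun_eq_iff orbit_inv_eq)
  then show "cyclic_on (inv (R v)) (- {v})"
    using assms by (simp add: rotation_def cyclic_on_def)
qed

lemma mirror_mirror_rotation: "rotation R \<Longrightarrow> mirror_rotation (mirror_rotation R) = R"
  by (simp add: fun_eq_iff mirror_rotation_def inv_inv_eq rotation_bij)

lemma rotation_iso_id: "rotation_iso R R id"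
  by (simp add: rotation_iso_def)

lemma rotation_iso_comp:
  "rotation_iso R R' \<sigma> \<Longrightarrow> rotation_iso R' R'' \<tau> \<Longrightarrow> rotation_iso R R'' (\<tau> \<circ> \<sigma>)"
  by (simp add: rotation_iso_def bij_comp)

lemma rotation_iso_inv:
  assumes "rotation_iso R R' \<sigma>"
  shows "rotation_iso R' R (inv \<sigma>)"
proof -
  have b: "bij \<sigma>" and eq: "\<And>v w. R' (\<sigma> v) (\<sigma> w) = \<sigma> (R v w)"
    using assms by (auto simp: rotation_iso_def)
  have "R (inv \<sigma> v) (inv \<sigma> w) = inv \<sigma> (R' v w)" for v w
    using eq[of "inv \<sigma> v" "inv \<sigma> w"] b by (simp add: bij_is_surj surj_f_inv_f bij_is_inj)
  then show ?thesis using b by (simp add: rotation_iso_def bij_imp_bij_inv)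
qed

lemma rotation_iso_mirror:
  assumes "rotation_iso R R' \<sigma>" "rotation R" "rotation R'"
  shows "rotation_iso (mirror_rotation R) (mirror_rotation R') \<sigma>"
proof -
  have "inv (R' (\<sigma> v)) (\<sigma> w) = \<sigma> (inv (R v) w)" for v w
  proof -
    have "R' (\<sigma> v) (\<sigma> (inv (R v) w)) = \<sigma> w"
      using assms(1) rotation_bij[OF assms(2), of v]
      by (simp add: rotation_iso_def bij_is_surj surj_f_inv_f)
    then show ?thesis using rotation_bij[OF assms(3), of "\<sigma> v"] by (metis bij_inv_eq_iff)
  qed
  then show ?thesis using assms(1) by (simp add: rotation_iso_def mirror_rotation_def)
qed

lemma rotation_conjugate:
  assumes "rotation R" "bij \<sigma>"
  shows "rotation (\<lambda>v w. \<sigma> (R (inv \<sigma> v) (inv \<sigma> w)))"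
    and "rotation_iso R (\<lambda>v w. \<sigma> (R (inv \<sigma> v) (inv \<sigma> w))) \<sigma>"
proof -
  show "rotation_iso R (\<lambda>v w. \<sigma> (R (inv \<sigma> v) (inv \<sigma> w))) \<sigma>"
    using assms(2) by (simp add: rotation_iso_def bij_is_inj)
  show "rotation (\<lambda>v w. \<sigma> (R (inv \<sigma> v) (inv \<sigma> w)))"
    unfolding rotation_def
  proof (intro allI conjI)
    fix v
    let ?u = "inv \<sigma> v"
    let ?f = "\<lambda>w. \<sigma> (R ?u (inv \<sigma> w))"
    have v: "\<sigma> ?u = v" using assms(2) by (simp add: bij_is_surj surj_f_inv_f)
    have "?f = \<sigma> \<circ> R ?u \<circ> inv \<sigma>" by auto
    then have "bij ?f"
      using assms(2) rotation_bij[OF assms(1)] by (simp add: bij_comp bij_imp_bij_inv)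
    moreover have "?f v = v" using assms(1) v by simp
    ultimately show "?f permutes - {v}" by (auto simp: permutes_def bij_iff)
    have "cyclic_on ?f (\<sigma> ` (- {?u}))"
      using assms by (intro cyclic_on_image[of "R ?u"]) (auto simp: rotation_def bij_is_inj)
    also have "\<sigma> ` (- {?u}) = - {v}"
      using assms(2) v by (simp add: bij_image_Compl_eq)
    finally show "cyclic_on ?f (- {v})" .
  qed
qed

subsection \<open>Faces\<close>

text \<open>The pair is the dart from \<open>v\<close> to \<open>w\<close>. Seen from
  \<open>w\<close>, the edge just traversed leads to \<open>v\<close>, so the walk leaves towards
  \<open>R w v\<close>.\<close>

fun dart_step :: "(vertex \<Rightarrow> vertex \<Rightarrow> vertex) \<Rightarrow> vertex \<times> vertex \<Rightarrow> vertex \<times> vertex" where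
  "dart_step R (v, w) = (w, R w v)"

definition face_count :: "(vertex \<Rightarrow> vertex \<Rightarrow> vertex) \<Rightarrow> nat" where
  "face_count R = card (orbit (dart_step R) ` {(v, w). v \<noteq> w})"

lemma dart_step_closed:
  "rotation R \<Longrightarrow> d \<in> {(v, w). v \<noteq> w} \<Longrightarrow> dart_step R d \<in> {(v, w). v \<noteq> w}"
  using rotation_neq[of R "fst d" "snd d"] by (cases d) auto

lemma face_count_iso:
  assumes "rotation_iso R R' \<sigma>" "rotation R"
  shows "face_count R' = face_count R"
proof -
  let ?S = "{(v :: vertex, w). v \<noteq> w}" and ?g = "map_prod \<sigma> \<sigma>"
  have inj: "\<sigma> v = \<sigma> w \<longleftrightarrow> v = w" for v w
    using assms(1) by (simp add: rotation_iso_def bij_def inj_eq)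
  have g: "inj_on ?g ?S" by (rule inj_onI) (auto simp: inj)
  moreover have "?g ` ?S \<subseteq> ?S" by (auto simp: inj)
  ultimately have "?g ` ?S = ?S" by (intro endo_inj_surj) auto
  moreover have comm: "dart_step R' (?g d) = ?g (dart_step R d)" for d
    using assms(1) by (cases d) (simp add: rotation_iso_def)
  have "card (orbit (dart_step R') ` ?g ` ?S) = card (orbit (dart_step R) ` ?S)"
    using dart_step_closed[OF assms(2)] comm g by (rule card_orbits_semiconj)
  ultimately show ?thesis by (simp add: face_count_def)
qed

text \<open>Reversing all darts turns face tracing in the mirror image into the inverse of face
  tracing in \<open>R\<close>: from \<open>(R w v, w)\<close> the mirrored step leads to
  \<open>(w, v)\<close>. A permutation and its inverse have the same orbits.\<close>

lemma face_count_mirror: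
  assumes "rotation R"
  shows "face_count (mirror_rotation R) = face_count R"
proof -
  let ?S = "{(v :: vertex, w). v \<noteq> w}" and ?f = "dart_step R" and ?g = "prod.swap"
  have "inj ?f"
    using rotation_bij[OF assms] by (auto simp: inj_on_def bij_def)
  then have b: "bij ?f" by (simp add: bij_def finite_UNIV_inj_surj)
  have "?f ` ?S \<subseteq> ?S" using dart_step_closed[OF assms] by (rule image_subsetI)
  then have S: "?f ` ?S = ?S"
    using b by (intro endo_inj_surj) (auto simp: bij_def intro: inj_on_subset)
  have closed: "inv ?f d \<in> ?S" if "d \<in> ?S" for d
  proof -
    from that have "d \<in> ?f ` ?S" unfolding S .
    then obtain e where "d = ?f e" "e \<in> ?S" by (rule imageE)
    then show ?thesis using b by (simp add: bij_is_inj)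
  qed
  have comm: "dart_step (mirror_rotation R) (?g d) = ?g (inv ?f d)" for d
  proof -
    obtain e where e: "d = ?f e" using b by (metis bij_pointE)
    obtain v w where vw: "e = (v, w)" by (cases e)
    show ?thesis
      using rotation_bij[OF assms, of w] b unfolding e inv_f_f[OF bij_is_inj[OF b]]
      by (simp add: vw mirror_rotation_def bij_is_inj)
  qed
  have "inj_on ?g ?S" by (auto intro: inj_onI)
  with closed comm have "card (orbit (dart_step (mirror_rotation R)) ` ?g ` ?S) =
      card (orbit (inv ?f) ` ?S)"
    by (rule card_orbits_semiconj)
  moreover have "?g ` ?S = ?S" by (auto simp: image_iff)
  moreover have "orbit (inv ?f) = orbit ?f"
  proof -
    have "permutation ?f"
      using b by (simp add: permutation)
    then show ?thesis by (simp add: fun_eq_iff orbit_inv_eq)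
  qed
  ultimately show ?thesis by (simp add: face_count_def)
qed

section \<open>Codes for rotations\<close>

type_synonym 'a row = "'a \<times> 'a \<times> 'a"

text \<open>The first entry is kept apart from the other three because in a normalised rotation it
  is known in advance; only the triple has to be stored.\<close>

fun cyc :: "'a \<Rightarrow> 'a row \<Rightarrow> 'a \<Rightarrow> 'a" where
  "cyc w (x, y, z) u =
     (if u = w then x else if u = x then y else if u = y then z else if u = z then w else u)"

fun map_row :: "('a \<Rightarrow> 'b) \<Rightarrow> 'a row \<Rightarrow> 'b row" where
  "map_row f (x, y, z) = (f x, f y, f z)"

fun rev_row :: "'a row \<Rightarrow> 'a row" where
  "rev_row (x, y, z) = (z, y, x)"

fun rows :: "'a row \<Rightarrow> 'a row list" where
  "rows (x, y, z) = [(x, y, z), (x, z, y), (y, x, z), (y, z, x), (z, x, y), (z, y, x)]"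

lemma cyc_map_row: "inj f \<Longrightarrow> cyc (f w) (map_row f r) (f u) = f (cyc w r u)"
  by (cases r) (simp add: inj_eq)

lemma cyc_rotate: "distinct [w, x, y, z] \<Longrightarrow> cyc w (x, y, z) = cyc x (y, z, w)"
  by (auto simp: fun_eq_iff)

lemma inv_cyc: "distinct [w, x, y, z] \<Longrightarrow> inv (cyc w (x, y, z)) = cyc w (z, y, x)"
  by (rule inv_equality) auto

lemma cyc_permutes:
  assumes "distinct [w, x, y, z]"
  shows "cyc w (x, y, z) permutes {w, x, y, z}"
proof (rule bij_imp_permutes)
  show "bij_betw (cyc w (x, y, z)) {w, x, y, z} {w, x, y, z}"
    by (rule bij_betw_byWitness[where f' = "cyc w (z, y, x)"]) (use assms in auto)
qed auto

lemma cyclic_on_cyc: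
  assumes "distinct [w, x, y, z]"
  shows "cyclic_on (cyc w (x, y, z)) {w, x, y, z}"
proof -
  have "map (cyc w (x, y, z)) [w, x, y, z] = rotate1 [w, x, y, z]" using assms by auto
  then have "orbit (cyc w (x, y, z)) w = set [w, x, y, z]" by (rule orbit_rotate1) simp
  then show ?thesis by (intro cyclic_on_singleI[of w]) auto
qed

lemma rotation_iso_relabel:
  assumes "bij \<sigma>" "\<And>v. R v = cyc (w v) (r v)" "\<And>v. R' (\<sigma> v) = cyc (\<sigma> (w v)) (map_row \<sigma> (r v))"
  shows "rotation_iso R R' \<sigma>"
  using assms by (simp add: rotation_iso_def cyc_map_row bij_is_inj)

definition next3 :: "('a \<Rightarrow> 'a) \<Rightarrow> 'a \<Rightarrow> 'a row" where
  "next3 f x = (f x, f (f x), f (f (f x)))"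

lemma next3_cyc: "distinct [w, x, y, z] \<Longrightarrow> next3 (cyc w (x, y, z)) w = (x, y, z)"
  by (auto simp: next3_def)

text \<open>The orbit of \<open>w\<close> has four elements, so a return to \<open>w\<close> after
  \<open>n < 4\<close> steps is impossible, and injectivity separates the remaining iterates. The
  fourth step then has no vertex left but \<open>w\<close>.\<close>

lemma rotation_next3:
  assumes "rotation R" "w \<noteq> v" "next3 (R v) w = (x, y, z)"
  shows "distinct [v, w, x, y, z]" and "R v = cyc w (x, y, z)"
proof -
  let ?f = "R v"
  have xyz: "x = ?f w" "y = ?f x" "z = ?f y" using assms(3) by (auto simp: next3_def)
  have inj: "?f a = ?f b \<longleftrightarrow> a = b" for a b
    using rotation_bij[OF assms(1)] by (simp add: bij_def inj_eq)
  have neq: "?f a \<noteq> v \<longleftrightarrow> a \<noteq> v" for a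
    using rotation_self[OF assms(1), of v] inj[of a v] by auto
  have orb: "orbit ?f w = - {v}"
    using assms(1,2) by (auto simp: rotation_def cyclic_on_alldef)
  have card: "card (orbit ?f w) = 4"
    unfolding orb by (simp add: Compl_eq_Diff_UNIV card_UNIV_vertex)
  have period: "(?f ^^ n) w \<noteq> w" if "0 < n" "n < 4" for n
  proof
    assume "(?f ^^ n) w = w"
    then have "orbit ?f w = (\<lambda>m. (?f ^^ m) w) ` {..<n}"
      using orbit_altdef_bounded that by (auto simp: orbit_altdef_bounded)
    then have "card (orbit ?f w) \<le> n" by (metis card_image_le card_lessThan finite_lessThan)
    with card that show False by simp
  qed
  have "x \<noteq> w" "y \<noteq> w" "z \<noteq> w"
    using period[of 1] period[of 2] period[of 3] by (auto simp: xyz numeral_2_eq_2 numeral_3_eq_3)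
  moreover have "x \<noteq> v" "y \<noteq> v" "z \<noteq> v"
    using assms(2) neq[of w] neq[of x] neq[of y] by (simp_all add: xyz)
  moreover have "x \<noteq> y" "x \<noteq> z" "y \<noteq> z"
    using \<open>x \<noteq> w\<close> \<open>y \<noteq> w\<close> inj[of x w] inj[of y w] inj[of x y] by (auto simp: xyz)
  ultimately show dist: "distinct [v, w, x, y, z]" using assms(2) by auto
  then have "UNIV = {v, w, x, y, z}" by (rule UNIV_vertex_distinct)
  moreover have "?f z \<noteq> v" "?f z \<noteq> x" "?f z \<noteq> y" "?f z \<noteq> z"
    using dist neq inj xyz by auto
  ultimately have "?f z = w" by blast
  show "?f = cyc w (x, y, z)"
  proof
    fix u
    have "u \<in> {v, w, x, y, z}" using \<open>UNIV = {v, w, x, y, z}\<close> by blast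
    then show "?f u = cyc w (x, y, z) u"
      using dist xyz \<open>?f z = w\<close> rotation_self[OF assms(1), of v] by auto
  qed
qed

text \<open>A code lists the cyclic orderings at \<open>V2\<close>, \<open>V3\<close>, \<open>V4\<close>, \<open>V5\<close>, each without its first
  entry \<open>V1\<close>. The ordering at \<open>V1\<close> is normalised to \<open>V2, V3, V4, V5\<close>.\<close>

type_synonym code = "vertex row \<times> vertex row \<times> vertex row \<times> vertex row"

fun row :: "code \<Rightarrow> vertex \<Rightarrow> vertex row" where
  "row c V1 = (V3, V4, V5)"
| "row (b, c, d, e) V2 = b"
| "row (b, c, d, e) V3 = c"
| "row (b, c, d, e) V4 = d"
| "row (b, c, d, e) V5 = e"

text \<open>The entry at which each cyclic ordering is cut open. At \<open>V1\<close> it is the end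
  of the starting dart; elsewhere it is \<open>V1\<close>, which is a neighbour of every other
  vertex.\<close>

fun base :: "vertex \<Rightarrow> vertex" where
  "base V1 = V2"
| "base V2 = V1"
| "base V3 = V1"
| "base V4 = V1"
| "base V5 = V1"

definition decode :: "code \<Rightarrow> vertex \<Rightarrow> vertex \<Rightarrow> vertex" where
  "decode c v = cyc (base v) (row c v)"

text \<open>With five vertices, distinctness means that \<open>x\<close>, \<open>y\<close>,
  \<open>z\<close> are the three remaining vertices in some order.\<close>

fun row_at :: "vertex \<Rightarrow> vertex row \<Rightarrow> bool" where
  "row_at v (x, y, z) \<longleftrightarrow> distinct [v, base v, x, y, z]"

definition codes :: "code set" where
  "codes = {c. \<forall>v. row_at v (row c v)}"

lemma all_vertex: "(\<forall>v. P v) \<longleftrightarrow> P V1 \<and> P V2 \<and> P V3 \<and> P V4 \<and> P V5"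
  by (metis vertex.exhaust)

lemma row_at_iff_rows:
  assumes "distinct [v, base v, x, y, z]"
  shows "row_at v r \<longleftrightarrow> r \<in> set (rows (x, y, z))"
proof -
  obtain x' y' z' where r: "r = (x', y', z')" by (cases r)
  have "UNIV = {v, base v, x, y, z}" using assms by (rule UNIV_vertex_distinct)
  then have "x' \<in> {v, base v, x, y, z}" "y' \<in> {v, base v, x, y, z}" "z' \<in> {v, base v, x, y, z}"
    by auto
  then show ?thesis using assms unfolding r by auto
qed

text \<open>Connects the condition used in proofs with the explicit lists over which the evaluation
  runs.\<close>

lemma codes_iff:
  "(b, c, d, e) \<in> codes \<longleftrightarrow> b \<in> set (rows (V3, V4, V5)) \<and> c \<in> set (rows (V2, V4, V5)) \<and>
     d \<in> set (rows (V2, V3, V5)) \<and> e \<in> set (rows (V2, V3, V4))"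
proof -
  have "row_at V2 b \<longleftrightarrow> b \<in> set (rows (V3, V4, V5))" by (rule row_at_iff_rows) simp
  moreover have "row_at V3 c \<longleftrightarrow> c \<in> set (rows (V2, V4, V5))" by (rule row_at_iff_rows) simp
  moreover have "row_at V4 d \<longleftrightarrow> d \<in> set (rows (V2, V3, V5))" by (rule row_at_iff_rows) simp
  moreover have "row_at V5 e \<longleftrightarrow> e \<in> set (rows (V2, V3, V4))" by (rule row_at_iff_rows) simp
  ultimately show ?thesis
    by (simp add: codes_def all_vertex del: rows.simps)
qed

lemma codes_row:
  assumes "c \<in> codes"
  obtains x y z where "row c v = (x, y, z)" "distinct [v, base v, x, y, z]"
proof -
  obtain x y z where "row c v = (x, y, z)" by (cases "row c v")
  moreover have "row_at v (row c v)" using assms by (simp add: codes_def)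
  ultimately show ?thesis using that by simp
qed

lemma rotation_decode:
  assumes "c \<in> codes"
  shows "rotation (decode c)"
  unfolding rotation_def decode_def
proof (intro allI)
  fix v
  obtain x y z where r: "row c v = (x, y, z)" "distinct [v, base v, x, y, z]"
    using assms by (rule codes_row)
  have "UNIV = {v, base v, x, y, z}" using r(2) by (rule UNIV_vertex_distinct)
  then have "- {v} = {base v, x, y, z}" using r(2) by auto
  then show "cyc (base v) (row c v) permutes - {v} \<and> cyclic_on (cyc (base v) (row c v)) (- {v})"
    using r cyc_permutes[of "base v" x y z] cyclic_on_cyc[of "base v" x y z] by simp
qed

lemma decode_inject:
  assumes "c \<in> codes" "c' \<in> codes" "decode c = decode c'"
  shows "c = c'"
proof -
  have "row a v = next3 (decode a v) (base v)" if a: "a \<in> codes" for a v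
  proof -
    obtain x y z where "row a v = (x, y, z)" "distinct [v, base v, x, y, z]"
      using a by (rule codes_row)
    then show ?thesis using next3_cyc[of "base v" x y z] by (simp add: decode_def)
  qed
  then have "row c v = row c' v" for v using assms by simp
  from this[of V2] this[of V3] this[of V4] this[of V5] show ?thesis
    by (cases c; cases c') simp
qed

text \<open>Normalisation at the dart \<open>(V1, V2)\<close>: a renaming makes the ordering at
  \<open>V1\<close> standard, and the other orderings are then read off from \<open>V1\<close>
  onwards.\<close>

lemma ex_code:
  assumes "rotation R"
  shows "\<exists>c\<in>codes. \<exists>\<sigma>. rotation_iso R (decode c) \<sigma>"
proof -
  obtain x y z where n: "next3 (R V1) V2 = (x, y, z)" by (cases "next3 (R V1) V2")
  have d: "distinct [V1, V2, x, y, z]" and R1: "R V1 = cyc V2 (x, y, z)"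
    using rotation_next3[OF assms _ n] by auto
  \<comment> \<open>The last branch fixes \<open>V1\<close> and \<open>V2\<close>, since
    \<open>x\<close>, \<open>y\<close>, \<open>z\<close> are \<open>V3\<close>, \<open>V4\<close>,
    \<open>V5\<close> in some order.\<close>
  define \<sigma> where "\<sigma> u = (if u = x then V3 else if u = y then V4 else if u = z then V5 else u)" for u
  have \<sigma>: "\<sigma> V1 = V1" "\<sigma> V2 = V2" "\<sigma> x = V3" "\<sigma> y = V4" "\<sigma> z = V5"
    using d by (auto simp: \<sigma>_def)
  have "surj \<sigma>"
  proof -
    have "v \<in> range \<sigma>" for v using \<sigma> by (cases v) (metis rangeI)+
    then show ?thesis by blast
  qed
  then have b: "bij \<sigma>" by (simp add: bij_def finite_UNIV_surj_inj)
  define R' where "R' v w = \<sigma> (R (inv \<sigma> v) (inv \<sigma> w))" for v w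
  have R': "rotation R'" and iso: "rotation_iso R R' \<sigma>"
    using rotation_conjugate[OF assms b] by (auto simp: R'_def[abs_def])
  have "R' (\<sigma> V1) (\<sigma> w) = cyc V2 (V3, V4, V5) (\<sigma> w)" for w
  proof -
    have "R' (\<sigma> V1) (\<sigma> w) = \<sigma> (cyc V2 (x, y, z) w)"
      using iso by (simp add: rotation_iso_def R1 del: cyc.simps)
    also have "\<dots> = cyc (\<sigma> V2) (map_row \<sigma> (x, y, z)) (\<sigma> w)"
      using b by (simp add: cyc_map_row bij_is_inj del: cyc.simps map_row.simps)
    finally show ?thesis by (simp add: \<sigma> del: cyc.simps)
  qed
  then have R'1: "R' V1 = cyc V2 (V3, V4, V5)"
    using \<open>surj \<sigma>\<close> \<sigma>(1) by (metis ext surjD)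
  let ?r = "\<lambda>v. next3 (R' v) (base v)"
  let ?c = "(?r V2, ?r V3, ?r V4, ?r V5)"
  have base: "base v \<noteq> v" for v by (cases v) auto
  have "?r V1 = (V3, V4, V5)" by (simp add: R'1 next3_def)
  then have row: "row ?c v = ?r v" for v by (cases v) simp_all
  have rc: "row_at v (?r v) \<and> R' v = cyc (base v) (?r v)" for v
  proof -
    obtain x y z where "?r v = (x, y, z)" by (cases "?r v")
    then show ?thesis using rotation_next3[OF R' base] by auto
  qed
  have "?c \<in> codes" unfolding codes_def mem_Collect_eq row using rc by blast
  moreover have "decode ?c = R'" unfolding fun_eq_iff decode_def row using rc by simp
  ultimately show ?thesis using iso by metis
qed

subsection \<open>Moves between codes\<close>

text \<open>The moves renormalise a code after a change of the starting dart, which is \<open>(V1, V2)\<close>: it is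
  turned to \<open>(V1, V3)\<close> or flipped to \<open>(V2, V1)\<close>. Mirroring keeps the starting dart. Turns and
  flips reach every dart, so they produce every code of the isomorphism class.\<close>

fun shift :: "vertex \<Rightarrow> vertex" where
  "shift V1 = V1"
| "shift V2 = V5"
| "shift V3 = V2"
| "shift V4 = V3"
| "shift V5 = V4"

fun turn :: "code \<Rightarrow> code" where
  "turn (b, c, d, e) = (map_row shift c, map_row shift d, map_row shift e, map_row shift b)"

text \<open>The reversed ordering at \<open>V1\<close> reads \<open>V2\<close>, \<open>V5\<close>,
  \<open>V4\<close>, \<open>V3\<close>; exchanging \<open>V3\<close> and \<open>V5\<close> makes it
  standard again.\<close>

fun swap35 :: "vertex \<Rightarrow> vertex" where
  "swap35 V1 = V1"
| "swap35 V2 = V2"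
| "swap35 V3 = V5"
| "swap35 V4 = V4"
| "swap35 V5 = V3"

definition mirror_row :: "vertex row \<Rightarrow> vertex row" where
  "mirror_row r = map_row swap35 (rev_row r)"

fun mirror :: "code \<Rightarrow> code" where
  "mirror (b, c, d, e) = (mirror_row b, mirror_row e, mirror_row d, mirror_row c)"

text \<open>The cyclic ordering \<open>V1, x, y, z\<close>, read off from the successor of \<open>V2\<close>.\<close>

fun after_V2 :: "vertex row \<Rightarrow> vertex row" where
  "after_V2 (x, y, z) = (if x = V2 then (y, z, V1) else if y = V2 then (z, V1, x) else (V1, x, y))"

text \<open>Here \<open>(x, y, z)\<close> is the row at \<open>V2\<close>, so the ordering there
  reads \<open>V1, x, y, z\<close> and is to become the standard one. The last branch is the case
  \<open>u = z\<close>.\<close>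

fun renaming :: "vertex row \<Rightarrow> vertex \<Rightarrow> vertex" where
  "renaming (x, y, z) u = (if u = V1 then V2 else if u = V2 then V1
     else if u = x then V3 else if u = y then V4 else V5)"

text \<open>The new \<open>V2\<close> is the old \<open>V1\<close>, whose ordering after the old
  \<open>V2\<close> is \<open>V3\<close>, \<open>V4\<close>, \<open>V5\<close>. The new
  \<open>V3\<close>, \<open>V4\<close>, \<open>V5\<close> are the old \<open>x\<close>,
  \<open>y\<close>, \<open>z\<close>; their orderings must now start at the old \<open>V2\<close>,
  hence \<open>after_V2\<close>.\<close>

fun flip_with :: "vertex row \<Rightarrow> code \<Rightarrow> code" where
  "flip_with (x, y, z) c =
     (map_row (renaming (x, y, z)) (V3, V4, V5),
      map_row (renaming (x, y, z)) (after_V2 (row c x)),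
      map_row (renaming (x, y, z)) (after_V2 (row c y)),
      map_row (renaming (x, y, z)) (after_V2 (row c z)))"

definition flip :: "code \<Rightarrow> code" where
  "flip c = flip_with (row c V2) c"

lemma row_at_map_row:
  "row_at v r \<Longrightarrow> inj \<sigma> \<Longrightarrow> \<sigma> v = v' \<Longrightarrow> \<sigma> (base v) = base v' \<Longrightarrow> row_at v' (map_row \<sigma> r)"
  by (cases r) (auto simp: inj_eq)

lemma bij_shift: "bij shift"
proof -
  have "inj shift" by (rule injI) (metis shift.simps vertex.exhaust vertex.distinct)
  then show ?thesis by (simp add: bij_def finite_UNIV_inj_surj)
qed

lemma bij_swap35: "bij swap35"
proof (rule bijI')
  fix y show "\<exists>x. y = swap35 x" by (cases y) (metis swap35.simps)+
next
  fix x y show "swap35 x = swap35 y \<longleftrightarrow> x = y" by (cases x; cases y) auto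
qed

lemma turn_codes:
  assumes "c \<in> codes"
  shows "turn c \<in> codes"
proof -
  note row_at_shift = row_at_map_row[OF _ bij_is_inj[OF bij_shift]]
  from row_at_shift[of V2 _ V5] row_at_shift[of V3 _ V2] row_at_shift[of V4 _ V3]
    row_at_shift[of V5 _ V4]
  show ?thesis
    using assms by (cases c) (simp add: codes_def all_vertex del: row_at.simps map_row.simps)
qed

lemma turn_iso: "rotation_iso (decode c) (decode (turn c)) shift"
proof (rule rotation_iso_relabel[OF bij_shift])
  \<comment> \<open>At \<open>V1\<close> the cycle is read from \<open>V3\<close>, which
    \<open>shift\<close> renames to \<open>V2\<close>; at the other vertices it already starts at
    the fixed vertex \<open>V1\<close>.\<close>
  let ?w = "\<lambda>v. if v = V1 then V3 else V1"
  let ?r = "\<lambda>v. if v = V1 then (V4, V5, V2) else row c v"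
  show "decode c v = cyc (?w v) (?r v)" for v
    using cyc_rotate[of V2 V3 V4 V5] by (cases v) (simp_all add: decode_def)
  show "decode (turn c) (shift v) = cyc (shift (?w v)) (map_row shift (?r v))" for v
    by (cases v; cases c) (simp_all add: decode_def)
qed

lemma mirror_codes:
  assumes "c \<in> codes"
  shows "mirror c \<in> codes"
proof -
  have rev: "row_at v (rev_row r)" if "row_at v r" for v r using that by (cases r) auto
  note row_at_mirror = row_at_map_row[OF rev bij_is_inj[OF bij_swap35], folded mirror_row_def]
  from row_at_mirror[of V2 _ V2] row_at_mirror[of V3 _ V5] row_at_mirror[of V4 _ V4]
    row_at_mirror[of V5 _ V3]
  show ?thesis using assms by (cases c) (simp add: codes_def all_vertex del: row_at.simps)
qed

lemma mirror_iso:
  assumes "c \<in> codes"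
  shows "rotation_iso (mirror_rotation (decode c)) (decode (mirror c)) swap35"
proof (rule rotation_iso_relabel[OF bij_swap35])
  fix v
  obtain x y z where r: "row c v = (x, y, z)" "distinct [v, base v, x, y, z]"
    using assms by (rule codes_row)
  show "mirror_rotation (decode c) v = cyc (base v) (rev_row (row c v))"
    using inv_cyc[of "base v" x y z] r by (simp add: mirror_rotation_def decode_def)
  show "decode (mirror c) (swap35 v) = cyc (swap35 (base v)) (map_row swap35 (rev_row (row c v)))"
    by (cases v; cases c) (simp_all add: decode_def mirror_row_def)
qed

lemma after_V2:
  assumes "row_at v r" "v \<noteq> V1" "v \<noteq> V2" "after_V2 r = (x, y, z)"
  shows "cyc V1 r = cyc V2 (x, y, z)" "distinct [v, V2, x, y, z]"
proof -
  obtain a b c where r: "r = (a, b, c)" by (cases r)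
  have v: "base v = V1" using assms(2) by (cases v) auto
  have d: "distinct [v, V1, a, b, c]" using assms(1) by (simp add: r v)
  have "UNIV = {v, V1, a, b, c}" using d by (rule UNIV_vertex_distinct)
  then have "V2 \<in> {v, V1, a, b, c}" by blast
  then have "V2 = a \<or> V2 = b \<or> V2 = c" using assms(3) by auto
  then have "cyc V1 r = cyc V2 (x, y, z) \<and> distinct [v, V2, x, y, z]"
  proof (elim disjE)
    assume a: "V2 = a"
    then have "cyc V1 r = cyc V2 (b, c, V1)" using cyc_rotate[of V1 a b c] d by (simp add: r)
    then show ?thesis using assms(4) d a by (auto simp: r simp del: cyc.simps)
  next
    assume b: "V2 = b"
    then have "cyc V1 r = cyc V2 (c, V1, a)"
      using cyc_rotate[of V1 a b c] cyc_rotate[of a b c V1] d by (auto simp: r simp del: cyc.simps)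
    then show ?thesis using assms(4) d b by (auto simp: r simp del: cyc.simps)
  next
    assume c: "V2 = c"
    then have "cyc V1 r = cyc V2 (V1, a, b)"
      using cyc_rotate[of c V1 a b] d by (auto simp: r simp del: cyc.simps)
    then show ?thesis using assms(4) d c by (auto simp: r simp del: cyc.simps)
  qed
  then show "cyc V1 r = cyc V2 (x, y, z)" "distinct [v, V2, x, y, z]" by auto
qed

lemma flip_properties:
  assumes "c \<in> codes"
  shows "flip c \<in> codes" and "rotation_iso (decode c) (decode (flip c)) (renaming (row c V2))"
proof -
  obtain x y z where r: "row c V2 = (x, y, z)" "distinct [V2, base V2, x, y, z]"
    using assms by (rule codes_row)
  define \<sigma> where "\<sigma> = renaming (x, y, z)"
  have \<sigma>: "\<sigma> V1 = V2" "\<sigma> V2 = V1" "\<sigma> x = V3" "\<sigma> y = V4" "\<sigma> z = V5"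
    using r(2) by (auto simp: \<sigma>_def)
  have "v \<in> range \<sigma>" for v using \<sigma> by (cases v) (metis rangeI)+
  then have "surj \<sigma>" by blast
  then have b: "bij \<sigma>" by (simp add: bij_def finite_UNIV_surj_inj)
  then have inj: "inj \<sigma>" by (rule bij_is_inj)
  have univ: "UNIV = {V2, V1, x, y, z}" using r(2) UNIV_vertex_distinct[of V2 V1 x y z] by simp
  \<comment> \<open>Every ordering is read from the entry that the renaming turns into the base
    entry: from \<open>V1\<close> at \<open>V2\<close>, and from \<open>V2\<close> everywhere
    else.\<close>
  let ?r = "\<lambda>v. if v = V1 then (V3, V4, V5) else if v = V2 then (x, y, z) else after_V2 (row c v)"
  let ?w = "\<lambda>v. if v = V2 then V1 else V2"
  have row: "row (flip c) (\<sigma> v) = map_row \<sigma> (?r v) \<and> base (\<sigma> v) = \<sigma> (?w v)" for v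
  proof -
    have "v \<in> {V2, V1, x, y, z}" using univ by blast
    then show ?thesis using r \<sigma> by (auto simp: flip_def \<sigma>_def[symmetric] simp del: renaming.simps)
  qed
  have good: "decode c v = cyc (?w v) (?r v) \<and> row_at (\<sigma> v) (map_row \<sigma> (?r v))" for v
  proof (cases "v = V1 \<or> v = V2")
    case True
    have "\<sigma> u \<noteq> V1 \<and> \<sigma> u \<noteq> V2" if "u \<noteq> V1" "u \<noteq> V2" for u
      using that inj_eq[OF inj, of u V1] inj_eq[OF inj, of u V2] \<sigma> by simp
    from this[of V3] this[of V4] this[of V5] True show ?thesis
      using r \<sigma> inj by (auto simp: decode_def inj_eq simp del: cyc.simps)
  next
    case False
    then have v: "base v = V1" "base (\<sigma> v) = \<sigma> V2"
      using row[of v] by (cases v; simp)+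
    obtain x' y' z' where a: "after_V2 (row c v) = (x', y', z')" by (cases "after_V2 (row c v)")
    have "row_at v (row c v)" using assms by (simp add: codes_def)
    from after_V2[OF this _ _ a] False
    have "cyc V1 (row c v) = cyc V2 (x', y', z')" "distinct [v, V2, x', y', z']" by auto
    then show ?thesis using False v inj by (auto simp: decode_def a inj_eq)
  qed
  have "row_at v (row (flip c) v)" for v
  proof -
    obtain u where "v = \<sigma> u" using \<open>surj \<sigma>\<close> by blast
    then show ?thesis using good[of u] row[of u] by simp
  qed
  then show "flip c \<in> codes" by (simp add: codes_def)
  have "rotation_iso (decode c) (decode (flip c)) \<sigma>"
  proof (rule rotation_iso_relabel[OF b])
    show "decode c v = cyc (?w v) (?r v)" for v using good by blast
    show "decode (flip c) (\<sigma> v) = cyc (\<sigma> (?w v)) (map_row \<sigma> (?r v))" for v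
      using row by (simp add: decode_def)
  qed
  then show "rotation_iso (decode c) (decode (flip c)) (renaming (row c V2))"
    by (simp add: \<sigma>_def r(1))
qed

section \<open>Normal forms at all twenty darts\<close>

definition turns :: "code \<Rightarrow> code set" where
  "turns c = {c, turn c, turn (turn c), turn (turn (turn c))}"

text \<open>Turns alone give the four starting darts at \<open>V1\<close>. A turn also brings any
  other vertex to the place of \<open>V2\<close>, the flip then moves the start to that vertex, and
  further turns run through its darts: \<open>4 + 4 * 4 = 20\<close>.\<close>

definition images :: "code \<Rightarrow> code set" where
  "images c = turns c \<union> (\<Union>d\<in>turns c. turns (flip d))"

lemma turns_iso: "d \<in> turns c \<Longrightarrow> \<exists>\<sigma>. rotation_iso (decode c) (decode d) \<sigma>"
  unfolding turns_def using turn_iso rotation_iso_id rotation_iso_comp by blast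

lemma turns_codes: "c \<in> codes \<Longrightarrow> d \<in> turns c \<Longrightarrow> d \<in> codes"
  by (auto simp: turns_def turn_codes)

lemma images_codes: "c \<in> codes \<Longrightarrow> d \<in> images c \<Longrightarrow> d \<in> codes"
  unfolding images_def using turns_codes flip_properties(1) by blast

lemma images_iso:
  assumes "c \<in> codes" "d \<in> images c"
  shows "\<exists>\<sigma>. rotation_iso (decode c) (decode d) \<sigma>"
  using assms turns_iso turns_codes flip_properties(2) rotation_iso_comp
  unfolding images_def by (elim UnE UN_E) meson+

lemma turns_reach:
  assumes "u \<noteq> V1"
  shows "\<exists>d\<in>turns c. \<exists>\<tau>. rotation_iso (decode c) (decode d) \<tau> \<and> \<tau> V1 = V1 \<and> \<tau> u = V2"
proof -
  note t = turn_iso and comp = rotation_iso_comp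
  have 1: "rotation_iso (decode c) (decode (turn c)) shift" by (rule t)
  have 2: "rotation_iso (decode c) (decode (turn (turn c))) (shift \<circ> shift)"
    using 1 t by (rule comp)
  have 3: "rotation_iso (decode c) (decode (turn (turn (turn c)))) (shift \<circ> (shift \<circ> shift))"
    using 2 t by (rule comp)
  show ?thesis
  proof (cases u)
    case V1 then show ?thesis using assms by simp
  next
    case V2 then show ?thesis by (auto simp: turns_def intro: rotation_iso_id)
  next
    case V3 then show ?thesis by (auto simp: turns_def intro!: exI[of _ shift] 1)
  next
    case V4 then show ?thesis by (intro bexI[of _ "turn (turn c)"] exI[of _ "shift \<circ> shift"]) (auto simp: turns_def intro!: 2)
  next
    case V5 then show ?thesis by (intro bexI[of _ "turn (turn (turn c))"] exI[of _ "shift \<circ> (shift \<circ> shift)"]) (auto simp: turns_def intro!: 3)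
  qed
qed

lemma images_reach:
  assumes "c \<in> codes" "v \<noteq> w"
  shows "\<exists>d\<in>images c. \<exists>\<tau>. rotation_iso (decode c) (decode d) \<tau> \<and> \<tau> v = V1 \<and> \<tau> w = V2"
proof (cases "v = V1")
  case True
  then show ?thesis using turns_reach[of w c] assms(2) by (auto simp: images_def)
next
  case False
  then obtain d \<tau> where d: "d \<in> turns c" "rotation_iso (decode c) (decode d) \<tau>" "\<tau> v = V2"
    using turns_reach[of v c] by blast
  have dc: "d \<in> codes" using assms(1) d(1) by (rule turns_codes)
  define \<tau>' where "\<tau>' = renaming (row d V2) \<circ> \<tau>"
  have iso: "rotation_iso (decode c) (decode (flip d)) \<tau>'"
    unfolding \<tau>'_def using d(2) flip_properties(2)[OF dc] by (rule rotation_iso_comp)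
  have v: "\<tau>' v = V1" by (cases "row d V2") (simp add: \<tau>'_def d(3))
  moreover have "\<tau>' w \<noteq> \<tau>' v"
    using iso assms(2) by (simp add: rotation_iso_def bij_def inj_eq)
  ultimately obtain e \<tau>'' where e: "e \<in> turns (flip d)" "rotation_iso (decode (flip d)) (decode e) \<tau>''"
    "\<tau>'' V1 = V1" "\<tau>'' (\<tau>' w) = V2"
    using turns_reach[of "\<tau>' w" "flip d"] by metis
  have "rotation_iso (decode c) (decode e) (\<tau>'' \<circ> \<tau>')" using iso e(2) by (rule rotation_iso_comp)
  moreover have "e \<in> images c" using d(1) e(1) by (auto simp: images_def)
  ultimately show ?thesis using v e by (intro bexI[of _ e] exI[of _ "\<tau>'' \<circ> \<tau>'"]) auto
qed

text \<open>Both codes have the same ordering at \<open>V1\<close>. Following it from the fixed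
  vertex \<open>V2\<close> shows in turn that \<open>V3\<close>, \<open>V4\<close> and
  \<open>V5\<close> are fixed.\<close>

lemma code_rigid:
  assumes "c \<in> codes" "c' \<in> codes" "rotation_iso (decode c) (decode c') \<sigma>" "\<sigma> V1 = V1" "\<sigma> V2 = V2"
  shows "c = c'"
proof -
  have V1: "decode a V1 = cyc V2 (V3, V4, V5)" for a by (simp add: decode_def)
  have eq: "decode c' (\<sigma> v) (\<sigma> w) = \<sigma> (decode c v w)" for v w
    using assms(3) by (simp add: rotation_iso_def)
  have 3: "\<sigma> V3 = V3" using eq[of V1 V2] assms(4,5) by (simp add: V1)
  have 4: "\<sigma> V4 = V4" using eq[of V1 V3] assms(4) 3 by (simp add: V1)
  have 5: "\<sigma> V5 = V5" using eq[of V1 V4] assms(4) 4 by (simp add: V1)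
  have "\<sigma> v = v" for v using assms(4,5) 3 4 5 by (cases v) simp_all
  then have "decode c = decode c'" using eq by (simp add: fun_eq_iff)
  with assms(1,2) show ?thesis by (rule decode_inject)
qed

text \<open>Given an isomorphism to \<open>c'\<close>, take the normal form of \<open>c\<close> at
  the dart that is sent to \<open>(V1, V2)\<close>. It and \<open>c'\<close> are normal forms at the
  same dart, so rigidity identifies them.\<close>

lemma images_iff:
  assumes "c \<in> codes" "c' \<in> codes"
  shows "c' \<in> images c \<longleftrightarrow> (\<exists>\<sigma>. rotation_iso (decode c) (decode c') \<sigma>)"
proof
  assume "\<exists>\<sigma>. rotation_iso (decode c) (decode c') \<sigma>"
  then obtain \<sigma> where \<sigma>: "rotation_iso (decode c) (decode c') \<sigma>" by blast
  then have b: "bij \<sigma>" by (simp add: rotation_iso_def)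
  have "inv \<sigma> V1 \<noteq> inv \<sigma> V2" using b by (metis bij_inv_eq_iff vertex.distinct(1))
  then obtain d \<tau> where d: "d \<in> images c" "rotation_iso (decode c) (decode d) \<tau>"
    "\<tau> (inv \<sigma> V1) = V1" "\<tau> (inv \<sigma> V2) = V2"
    using images_reach[OF assms(1)] by blast
  have "rotation_iso (decode c') (decode d) (\<tau> \<circ> inv \<sigma>)"
    using rotation_iso_inv[OF \<sigma>] d(2) by (rule rotation_iso_comp)
  then have "c' = d"
    using code_rigid[OF assms(2) images_codes[OF assms(1) d(1)]] d(3,4) by simp
  then show "c' \<in> images c" using d(1) by simp
qed (rule images_iso[OF assms(1)])

subsection \<open>Minimal codes\<close>

text \<open>Quantification over \<open>turns\<close> and \<open>images\<close> is spelled out as a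
  conjunction so that the evaluation builds no sets.\<close>

definition all_turns :: "(code \<Rightarrow> bool) \<Rightarrow> code \<Rightarrow> bool" where
  "all_turns P c \<longleftrightarrow> P c \<and> P (turn c) \<and> P (turn (turn c)) \<and> P (turn (turn (turn c)))"

definition all_images :: "(code \<Rightarrow> bool) \<Rightarrow> code \<Rightarrow> bool" where
  "all_images P c \<longleftrightarrow> all_turns P c \<and> all_turns (all_turns P \<circ> flip) c"

lemma all_images_iff: "all_images P c \<longleftrightarrow> (\<forall>d\<in>images c. P d)"
proof -
  have turns: "all_turns Q a \<longleftrightarrow> (\<forall>d\<in>turns a. Q d)" for Q a
    by (simp add: all_turns_def turns_def)
  show ?thesis by (auto simp: all_images_def turns images_def)
qed

definition minimal :: "code \<Rightarrow> bool" where
  "minimal c \<longleftrightarrow> all_images ((\<le>) c) c \<and> all_images ((\<le>) c) (mirror c)"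

text \<open>Membership of \<open>c\<close> among the images of its mirror, expressed by negation so
  that the executable \<open>all_images\<close> can be used again.\<close>

definition self_mirror :: "code \<Rightarrow> bool" where
  "self_mirror c \<longleftrightarrow> \<not> all_images (\<lambda>d. d \<noteq> c) (mirror c)"

definition related :: "(vertex \<Rightarrow> vertex \<Rightarrow> vertex) \<Rightarrow> (vertex \<Rightarrow> vertex \<Rightarrow> vertex) \<Rightarrow> bool" where
  "related R R' \<longleftrightarrow>
     (\<exists>\<sigma>. rotation_iso R R' \<sigma>) \<or> (\<exists>\<sigma>. rotation_iso (mirror_rotation R) R' \<sigma>)"

lemma related_sym:
  assumes "related R R'" "rotation R" "rotation R'"
  shows "related R' R"
  using assms unfolding related_def
  by (metis mirror_mirror_rotation rotation_iso_inv rotation_iso_mirror rotation_mirror)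

text \<open>Isomorphisms pass to mirror images and mirroring is an involution, so two relations
  through the mirror combine to a direct isomorphism.\<close>

lemma related_trans:
  assumes "related R R'" "related R' R''" "rotation R" "rotation R'" "rotation R''"
  shows "related R R''"
  using assms unfolding related_def
  by (metis mirror_mirror_rotation rotation_iso_comp rotation_iso_mirror rotation_mirror)

lemma related_decode_iff:
  assumes "c \<in> codes" "c' \<in> codes"
  shows "related (decode c) (decode c') \<longleftrightarrow> c' \<in> images c \<union> images (mirror c)"
proof -
  have m: "rotation_iso (mirror_rotation (decode c)) (decode (mirror c)) swap35"
    using assms(1) by (rule mirror_iso)
  have "(\<exists>\<sigma>. rotation_iso (mirror_rotation (decode c)) (decode c') \<sigma>) \<longleftrightarrow>
      (\<exists>\<sigma>. rotation_iso (decode (mirror c)) (decode c') \<sigma>)"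
    using m rotation_iso_inv[OF m] rotation_iso_comp by metis
  then show ?thesis
    using assms by (simp add: related_def images_iff mirror_codes)
qed

lemma self_mirror_iff:
  assumes "c \<in> codes"
  shows "self_mirror c \<longleftrightarrow> (\<exists>\<sigma>. rotation_iso (mirror_rotation (decode c)) (decode c) \<sigma>)"
proof -
  have m: "rotation_iso (mirror_rotation (decode c)) (decode (mirror c)) swap35"
    using assms by (rule mirror_iso)
  have "self_mirror c \<longleftrightarrow> c \<in> images (mirror c)"
    by (auto simp: self_mirror_def all_images_iff)
  also have "\<dots> \<longleftrightarrow> (\<exists>\<sigma>. rotation_iso (decode (mirror c)) (decode c) \<sigma>)"
    using assms by (intro images_iff mirror_codes)
  finally show ?thesis
    using m rotation_iso_inv[OF m] rotation_iso_comp by metis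
qed

lemma minimal_iff:
  assumes "c \<in> codes"
  shows "minimal c \<longleftrightarrow> (\<forall>d\<in>codes. related (decode c) (decode d) \<longrightarrow> c \<le> d)"
  using assms related_decode_iff[OF assms] images_codes mirror_codes
  unfolding minimal_def all_images_iff by blast

lemma ex_minimal:
  assumes "c \<in> codes"
  shows "\<exists>m\<in>codes. minimal m \<and> related (decode c) (decode m)"
proof -
  let ?C = "{d \<in> codes. related (decode c) (decode d)}"
  have "c \<in> ?C" using assms rotation_iso_id by (auto simp: related_def)
  then have m: "Min ?C \<in> ?C" by (intro Min_in) (simp, blast)
  have "minimal (Min ?C)"
    unfolding minimal_iff[OF CollectD[OF m, THEN conjunct1]]
  proof (intro ballI impI)
    fix d assume d: "d \<in> codes" "related (decode (Min ?C)) (decode d)"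
    have "related (decode c) (decode d)"
      using m d assms by (intro related_trans[OF _ d(2)] rotation_decode) blast+
    then show "Min ?C \<le> d" using d(1) by (intro Min_le) simp_all
  qed
  then show ?thesis using m by blast
qed

lemma minimal_unique:
  assumes "c \<in> codes" "c' \<in> codes" "minimal c" "minimal c'" "related (decode c) (decode c')"
  shows "c = c'"
proof -
  have "related (decode c') (decode c)" using related_sym[OF assms(5)] rotation_decode assms(1,2) by blast
  then have "c' \<le> c" using minimal_iff[OF assms(2)] assms(1,4) by blast
  moreover have "c \<le> c'" using minimal_iff[OF assms(1)] assms(2,3,5) by blast
  ultimately show ?thesis by (rule antisym[rotated])
qed

section \<open>Enumeration and evaluation\<close>

definition minimal_codes :: "code list" where
  "minimal_codes =
     concat (map (\<lambda>b. concat (map (\<lambda>c. concat (map (\<lambda>d.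
       filter minimal (map (\<lambda>e. (b, c, d, e)) (rows (V2, V3, V4))))
       (rows (V2, V3, V5)))) (rows (V2, V4, V5)))) (rows (V3, V4, V5)))"

lemma set_minimal_codes: "set minimal_codes = {c \<in> codes. minimal c}"
proof -
  have "(b, c, d, e) \<in> set minimal_codes \<longleftrightarrow> (b, c, d, e) \<in> codes \<and> minimal (b, c, d, e)" for b c d e
    unfolding minimal_codes_def codes_iff by (auto simp del: rows.simps)
  then show ?thesis by (auto simp del: rows.simps)
qed

definition dart_list :: "(vertex \<times> vertex) list" where
  "dart_list = (let vs = [V1, V2, V3, V4, V5] in filter (\<lambda>(v, w). v \<noteq> w) (List.product vs vs))"

lemma set_dart_list: "set dart_list = {(v, w). v \<noteq> w}"
proof -
  have "set [V1, V2, V3, V4, V5] = UNIV" by (simp add: UNIV_vertex)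
  then show ?thesis unfolding dart_list_def Let_def set_filter set_product by (simp only:) simp
qed

lemma distinct_dart_list: "distinct dart_list"
  by (simp add: dart_list_def Let_def distinct_product)

definition face_cycles :: "code \<Rightarrow> (vertex \<times> vertex) list list" where
  "face_cycles c =
     trace_cycles (dart_step (decode c)) (tl dart_list) [hd dart_list] (dart_step (decode c) (hd dart_list))"

definition count_classes :: "code list \<Rightarrow> bool" where
  "count_classes L \<longleftrightarrow>
     distinct L \<and> length (filter self_mirror L) = 17 \<and> length (filter (Not \<circ> self_mirror) L) = 14"

text \<open>The list is an argument so that one enumeration serves both the validation of the traced
  faces and the count.\<close>

definition check_codes :: "code list \<Rightarrow> bool" where
  "check_codes L \<longleftrightarrow>
     list_all (\<lambda>c. cycle_decomposition (dart_step (decode c)) dart_list (face_cycles c)) L \<and>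
     count_classes (filter (\<lambda>c. length (face_cycles c) = 3) L)"

declare trace_cycles.simps [code]

text \<open>All computation happens here, by rewriting inside the logic. Faces are traced for the
  least codes only, one per equivalence class.\<close>

lemma check_minimal_codes: "check_codes minimal_codes"
  by code_simp

lemma card_minimal_codes:
  "card {c \<in> codes. minimal c \<and> face_count (decode c) = 3 \<and> self_mirror c} = 17"
  "card {c \<in> codes. minimal c \<and> face_count (decode c) = 3 \<and> \<not> self_mirror c} = 14"
proof -
  let ?L = "filter (\<lambda>c. length (face_cycles c) = 3) minimal_codes"
  have "face_count (decode c) = length (face_cycles c)" if "c \<in> set minimal_codes" for c
  proof -
    have "cycle_decomposition (dart_step (decode c)) dart_list (face_cycles c)"
      using check_minimal_codes that by (simp add: check_codes_def list_all_iff)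
    then have "card (orbit (dart_step (decode c)) ` set dart_list) = length (face_cycles c)"
      using distinct_dart_list by (rule card_orbits_cycle_decomposition)
    then show ?thesis by (simp add: face_count_def set_dart_list)
  qed
  then have sets:
    "{c \<in> codes. minimal c \<and> face_count (decode c) = 3 \<and> self_mirror c} = set (filter self_mirror ?L)"
    "{c \<in> codes. minimal c \<and> face_count (decode c) = 3 \<and> \<not> self_mirror c} =
       set (filter (Not \<circ> self_mirror) ?L)"
    using set_minimal_codes by auto
  have "count_classes ?L" using check_minimal_codes by (simp add: check_codes_def)
  then show "card {c \<in> codes. minimal c \<and> face_count (decode c) = 3 \<and> self_mirror c} = 17"
    and "card {c \<in> codes. minimal c \<and> face_count (decode c) = 3 \<and> \<not> self_mirror c} = 14"
    unfolding sets count_classes_def by (simp_all only: distinct_card distinct_filter)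
qed

section \<open>Rotation systems of \<open>K\<^sub>5\<close>\<close>

abbreviation edge :: "vertex \<Rightarrow> vertex \<Rightarrow> nat set" where
  "edge v w \<equiv> {label v, label w}"

lemma edge_eq_iff [simp]: "edge v w = edge v u \<longleftrightarrow> w = u"
  by (auto simp: doubleton_eq_iff)

lemma range_label: "range label = K5_vertices"
proof -
  have "K5_vertices = {1, 2, 3, 4, 5}" by (auto simp: K5_vertices_def)
  then show ?thesis by (simp add: UNIV_vertex)
qed

lemma label_in_K5 [simp]: "label v \<in> K5_vertices"
  using range_label by blast

lemma bij_betw_label: "bij_betw label UNIV K5_vertices"
  by (simp add: bij_betw_def range_label inj_on_def)

lemma K5_verticesE:
  assumes "n \<in> K5_vertices"
  obtains v where "n = label v"
  using assms range_label by blast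

lemma edge_in_K5: "v \<noteq> w \<Longrightarrow> edge v w \<in> K5_edges"
  by (simp add: K5_edges_def)

lemma K5_edgesE:
  assumes "e \<in> K5_edges"
  obtains v w where "v \<noteq> w" "e = edge v w"
  using assms unfolding K5_edges_def by (elim nsets2_E K5_verticesE) auto

lemma bij_betw_edge: "bij_betw (edge v) (- {v}) (incident_edges K5_edges (label v))"
proof -
  have "incident_edges K5_edges (label v) \<subseteq> edge v ` (- {v})"
  proof
    fix e assume "e \<in> incident_edges K5_edges (label v)"
    then have e: "e \<in> K5_edges" "label v \<in> e" by (auto simp: incident_edges_def)
    then obtain a b where ab: "a \<noteq> b" "e = edge a b" by (blast elim: K5_edgesE)
    with e have "v = a \<or> v = b" by auto
    then show "e \<in> edge v ` (- {v})" using ab by (auto simp: insert_commute)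
  qed
  moreover have "edge v ` (- {v}) \<subseteq> incident_edges K5_edges (label v)"
    using edge_in_K5 by (auto simp: incident_edges_def)
  ultimately show ?thesis by (auto simp: bij_betw_def inj_on_def)
qed

lemma edge_incident: "v \<noteq> w \<Longrightarrow> edge v w \<in> incident_edges K5_edges (label v)"
  by (simp add: incident_edges_def edge_in_K5)

lemma incident_edgesE:
  assumes "e \<in> incident_edges K5_edges (label v)"
  obtains w where "w \<noteq> v" "e = edge v w"
  using assms bij_betw_imp_surj_on[OF bij_betw_edge, of v] by blast

lemma connected_K5: "connected_simple_graph K5_vertices K5_edges"
proof -
  have "(u, v) \<in> {(x, y). {x, y} \<in> K5_edges}\<^sup>*" if "u \<in> K5_vertices" "v \<in> K5_vertices" for u v
    using that by (cases "u = v") (auto simp: K5_edges_def)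
  then show ?thesis
    by (auto simp: connected_simple_graph_def K5_edges_def K5_vertices_def)
qed

lemma card_K5: "card K5_vertices = 5" "card K5_edges = 10"
  by (simp_all add: K5_vertices_def K5_edges_def card_nsets choose_two)

section \<open>Correspondence between embeddings and neighbour permutations\<close>

definition coded :: "nat rotation \<Rightarrow> (vertex \<Rightarrow> vertex \<Rightarrow> vertex) \<Rightarrow> bool" where
  "coded \<rho> R \<longleftrightarrow> rotation_system K5_vertices K5_edges \<rho> \<and> rotation R \<and>
     (\<forall>v w. v \<noteq> w \<longrightarrow> \<rho> (label v) (edge v w) = edge v (R v w))"

lemma coded_rotation_system: "coded \<rho> R \<Longrightarrow> rotation_system K5_vertices K5_edges \<rho>"
  and coded_rotation: "coded \<rho> R \<Longrightarrow> rotation R"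
  and coded_edge: "coded \<rho> R \<Longrightarrow> v \<noteq> w \<Longrightarrow> \<rho> (label v) (edge v w) = edge v (R v w)"
  by (auto simp: coded_def)

text \<open>At each vertex the cyclic permutation of edges is carried over by \<open>?h\<close>,
  which sends an edge at \<open>v\<close> to its other end.\<close>

lemma ex_coded_rotation:
  assumes "rotation_system K5_vertices K5_edges \<rho>"
  shows "\<exists>R. coded \<rho> R"
proof -
  have "\<exists>q. q permutes - {v} \<and> cyclic_on q (- {v}) \<and>
      (\<forall>w. v \<noteq> w \<longrightarrow> \<rho> (label v) (edge v w) = edge v (q w))" for v
  proof -
    let ?I = "incident_edges K5_edges (label v)" and ?h = "inv_into (- {v}) (edge v)"
    have I: "\<rho> (label v) permutes ?I" "cyclic_on (\<rho> (label v)) ?I"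
      using assms by (auto simp: rotation_system_def)
    obtain q where q: "q permutes - {v}" "cyclic_on q (- {v})"
      "\<And>e. e \<in> ?I \<Longrightarrow> q (?h e) = ?h (\<rho> (label v) e)"
      using transport_cyclic_permutation[OF I bij_betw_inv_into[OF bij_betw_edge]] by blast
    have "\<rho> (label v) (edge v w) = edge v (q w)" if "v \<noteq> w" for w
    proof -
      have e: "edge v w \<in> ?I" using that by (rule edge_incident)
      have "?h (edge v w) = w"
        using that by (intro bij_betw_inv_into_left[OF bij_betw_edge]) simp
      moreover have "edge v (?h (\<rho> (label v) (edge v w))) = \<rho> (label v) (edge v w)"
        using e I(1) by (intro bij_betw_inv_into_right[OF bij_betw_edge]) (simp add: permutes_in_image)
      ultimately show ?thesis using q(3)[OF e] by simp
    qed
    with q show ?thesis by blast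
  qed
  then have "\<exists>R. \<forall>v. R v permutes - {v} \<and> cyclic_on (R v) (- {v}) \<and>
      (\<forall>w. v \<noteq> w \<longrightarrow> \<rho> (label v) (edge v w) = edge v (R v w))"
    by (intro choice allI)
  then show ?thesis using assms unfolding coded_def rotation_def by blast
qed

lemma ex_coded_rotation_system:
  assumes "rotation R"
  shows "\<exists>\<rho>. coded \<rho> R"
proof -
  have "\<exists>q. q permutes incident_edges K5_edges (label v) \<and>
      cyclic_on q (incident_edges K5_edges (label v)) \<and>
      (\<forall>w. v \<noteq> w \<longrightarrow> q (edge v w) = edge v (R v w))" for v
  proof -
    have R: "R v permutes - {v}" "cyclic_on (R v) (- {v})"
      using assms by (auto simp: rotation_def)
    from transport_cyclic_permutation[OF R bij_betw_edge] show ?thesis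
      by (metis ComplI singletonD)
  qed
  then obtain q where q: "\<And>v. q v permutes incident_edges K5_edges (label v)"
    "\<And>v. cyclic_on (q v) (incident_edges K5_edges (label v))"
    "\<And>v w. v \<noteq> w \<Longrightarrow> q v (edge v w) = edge v (R v w)"
    by metis
  \<comment> \<open>Off the vertex set the value must be \<open>id\<close>, the default that
    \<open>rotation_system\<close> prescribes.\<close>
  define \<rho> where "\<rho> n = (if n \<in> K5_vertices then q (inv label n) else id)" for n
  have \<rho>: "\<rho> (label v) = q v" for v by (simp add: \<rho>_def inj_on_def inv_f_f)
  have "rotation_system K5_vertices K5_edges \<rho>"
    unfolding rotation_system_def
  proof (intro conjI ballI allI impI)
    fix n assume "n \<in> K5_vertices"
    then obtain v where "n = label v" by (rule K5_verticesE)
    then show "\<rho> n permutes incident_edges K5_edges n" "cyclic_on (\<rho> n) (incident_edges K5_edges n)"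
      using q by (simp_all add: \<rho>)
  qed (simp add: \<rho>_def)
  then have "coded \<rho> R" using assms q(3) by (simp add: coded_def \<rho>)
  then show ?thesis by blast
qed

lemma coded_reversal:
  assumes "coded \<rho> R"
  shows "coded (reversal \<rho>) (mirror_rotation R)"
proof -
  have R: "rotation R" and rs: "rotation_system K5_vertices K5_edges \<rho>"
    using assms by (auto simp: coded_def)
  have p: "\<rho> n permutes incident_edges K5_edges n" "cyclic_on (\<rho> n) (incident_edges K5_edges n)"
    if "n \<in> K5_vertices" for n
    using rs that by (auto simp: rotation_system_def)
  have "rotation_system K5_vertices K5_edges (reversal \<rho>)"
    unfolding rotation_system_def reversal_def
  proof (intro conjI ballI allI impI)
    fix n assume n: "n \<in> K5_vertices"
    show "inv (\<rho> n) permutes incident_edges K5_edges n" using p(1)[OF n] by (rule permutes_inv)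
    have "finite (incident_edges K5_edges n)" using p(2)[OF n] by (rule finite_cyclic_on)
    then have "permutation (\<rho> n)" using p(1)[OF n] permutation_permutes by blast
    then have "orbit (inv (\<rho> n)) = orbit (\<rho> n)" by (simp add: fun_eq_iff orbit_inv_eq)
    then show "cyclic_on (inv (\<rho> n)) (incident_edges K5_edges n)"
      using p(2)[OF n] by (simp add: cyclic_on_def)
  next
    fix n assume "n \<notin> K5_vertices"
    then show "inv (\<rho> n) = id" using rs by (simp add: rotation_system_def)
  qed
  moreover have "reversal \<rho> (label v) (edge v w) = edge v (mirror_rotation R v w)" if "v \<noteq> w" for v w
  proof -
    have "mirror_rotation R v w \<noteq> v"
      using rotation_neq[OF rotation_mirror[OF R]] that by metis
    then have "\<rho> (label v) (edge v (mirror_rotation R v w)) = edge v (R v (mirror_rotation R v w))"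
      using coded_edge[OF assms] by metis
    also have "\<dots> = edge v w"
      using rotation_bij[OF R] by (simp add: mirror_rotation_def bij_is_surj surj_f_inv_f)
    finally have "\<rho> (label v) (edge v (mirror_rotation R v w)) = edge v w" .
    moreover have "bij (\<rho> (label v))" using p(1)[of "label v"] permutes_bij by simp
    ultimately show ?thesis unfolding reversal_def by (metis bij_inv_eq_iff)
  qed
  ultimately show ?thesis using rotation_mirror[OF R] by (simp add: coded_def)
qed

text \<open>A dart \<open>(v, w)\<close> corresponds to the vertex \<open>v\<close> with the edge
  joining it to \<open>w\<close>. The two face steps are compared for \<open>v \<noteq> w\<close>
  only, where \<open>other_end\<close> has its intended value.\<close>

lemma card_faces_coded:
  assumes "coded \<rho> R"
  shows "card (faces K5_vertices K5_edges \<rho>) = face_count R"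
proof -
  let ?S = "{(v :: vertex, w). v \<noteq> w}" and ?g = "\<lambda>(v, w). (label v, edge v w)"
  have comm: "face_step \<rho> (?g d) = ?g (dart_step R d)" if dart: "d \<in> ?S" for d
  proof -
    obtain v w where d: "d = (v, w)" "v \<noteq> w" using dart by blast
    have "other_end (edge v w) (label v) = label w"
      unfolding other_end_def using d(2) by (intro the_equality) auto
    then show ?thesis
      using coded_edge[OF assms, of w v] d by (simp add: face_step_def insert_commute)
  qed
  have inj: "inj_on ?g ?S" by (rule inj_onI) (auto simp del: insert_iff)
  have img: "?g ` ?S = darts K5_vertices K5_edges"
  proof (intro equalityI subsetI)
    fix d assume "d \<in> ?g ` ?S"
    then show "d \<in> darts K5_vertices K5_edges"
      using edge_incident by (auto simp: darts_def)
  next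
    fix d assume "d \<in> darts K5_vertices K5_edges"
    then obtain n e where d: "d = (n, e)" "n \<in> K5_vertices" "e \<in> incident_edges K5_edges n"
      by (auto simp: darts_def)
    obtain v where v: "n = label v" using d(2) by (rule K5_verticesE)
    obtain w where "w \<noteq> v" "e = edge v w" using d(3) unfolding v by (rule incident_edgesE)
    then have "d = ?g (v, w)" "(v, w) \<in> ?S" using d(1) v by auto
    then show "d \<in> ?g ` ?S" by (rule image_eqI)
  qed
  have "card (orbit (face_step \<rho>) ` ?g ` ?S) = card (orbit (dart_step R) ` ?S)"
    using dart_step_closed[OF coded_rotation[OF assms]] comm inj by (rule card_orbits_semiconj)
  then show ?thesis by (simp add: faces_def face_count_def img)
qed

lemma double_torus_iff:
  assumes "coded \<rho> R"
  shows "\<rho> \<in> double_torus_embeddings K5_vertices K5_edges \<longleftrightarrow> face_count R = 3"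
  using connected_K5 coded_rotation_system[OF assms] card_faces_coded[OF assms]
  by (auto simp: two_cell_embeddings_def euler_characteristic_def card_K5)

text \<open>The edge permutation is forced. Incidence puts the images of both ends of an edge into
  the image of the edge, which has just two elements. Conversely, taking images of edges under the
  vertex permutation supplies it.\<close>

lemma isomorphic_embeddings_iff:
  assumes "coded \<rho> R" "coded \<rho>' R'"
  shows "isomorphic_embeddings K5_vertices K5_edges \<rho> \<rho>' \<longleftrightarrow> (\<exists>s. rotation_iso R R' s)"
proof
  assume "isomorphic_embeddings K5_vertices K5_edges \<rho> \<rho>'"
  then obtain \<sigma> \<tau> where \<sigma>: "\<sigma> permutes K5_vertices" and \<tau>: "\<tau> permutes K5_edges"
    and all: "\<forall>n\<in>K5_vertices. \<forall>e\<in>K5_edges. n \<in> e \<longleftrightarrow> \<sigma> n \<in> \<tau> e"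
      "\<forall>n\<in>K5_vertices. \<forall>e\<in>incident_edges K5_edges n. \<rho>' (\<sigma> n) (\<tau> e) = \<tau> (\<rho> n e)"
    unfolding isomorphic_embeddings_def by (elim exE conjE)
  have inc: "label v \<in> e \<longleftrightarrow> \<sigma> (label v) \<in> \<tau> e" if "e \<in> K5_edges" for v e
    using all(1) that label_in_K5 by blast
  have comm: "\<rho>' (\<sigma> (label v)) (\<tau> e) = \<tau> (\<rho> (label v) e)"
    if "e \<in> incident_edges K5_edges (label v)" for v e
    using all(2) that label_in_K5 by blast
  define s where "s v = inv label (\<sigma> (label v))" for v
  have s: "label (s v) = \<sigma> (label v)" for v
    unfolding s_def using \<sigma> by (intro f_inv_into_f) (simp add: range_label permutes_in_image)
  have s_inj: "s v = s w \<longleftrightarrow> v = w" for v w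
  proof -
    have "s v = s w \<longleftrightarrow> label (s v) = label (s w)" by simp
    also have "\<dots> \<longleftrightarrow> label v = label w"
      unfolding s using permutes_inj[OF \<sigma>] by (simp only: inj_eq)
    finally show ?thesis by simp
  qed
  then have b: "bij s" by (simp add: bij_def inj_def finite_UNIV_inj_surj)
  have \<tau>_edge: "\<tau> (edge v w) = edge (s v) (s w)" if "v \<noteq> w" for v w
  proof -
    have e: "edge v w \<in> K5_edges" using that by (rule edge_in_K5)
    then have "\<tau> (edge v w) \<in> K5_edges" using \<tau> by (simp add: permutes_in_image)
    then obtain a b where ab: "\<tau> (edge v w) = edge a b" by (rule K5_edgesE)
    have "label (s v) \<in> edge a b" "label (s w) \<in> edge a b"
      using inc[OF e, of v] inc[OF e, of w] by (simp_all add: s ab)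
    then show ?thesis using s_inj[of v w] that unfolding ab by auto
  qed
  have "R' (s v) (s w) = s (R v w)" for v w
  proof (cases "v = w")
    case True
    then show ?thesis using assms[THEN coded_rotation] by simp
  next
    case False
    have "R v w \<noteq> v" using rotation_neq[OF coded_rotation[OF assms(1)]] False by metis
    have "edge (s v) (R' (s v) (s w)) = \<rho>' (label (s v)) (edge (s v) (s w))"
      using coded_edge[OF assms(2)] s_inj False by simp
    also have "\<dots> = \<tau> (\<rho> (label v) (edge v w))"
      using comm[OF edge_incident[OF False]] False by (simp add: s \<tau>_edge)
    also have "\<dots> = \<tau> (edge v (R v w))" using coded_edge[OF assms(1) False] by simp
    also have "\<dots> = edge (s v) (s (R v w))" using \<open>R v w \<noteq> v\<close> by (intro \<tau>_edge) simp
    finally show ?thesis by (simp only: edge_eq_iff)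
  qed
  then show "\<exists>s. rotation_iso R R' s" using b by (auto simp: rotation_iso_def)
next
  assume "\<exists>s. rotation_iso R R' s"
  then obtain s where b: "bij s" and s: "\<And>v w. R' (s v) (s w) = s (R v w)"
    by (auto simp: rotation_iso_def)
  have s_inj: "s v = s w \<longleftrightarrow> v = w" for v w using b by (simp add: bij_def inj_eq)
  define \<sigma> where "\<sigma> n = (if n \<in> K5_vertices then label (s (inv label n)) else n)" for n
  have "s permutes UNIV" using b by (simp add: permutes_def bij_iff)
  then have \<sigma>: "\<sigma> permutes K5_vertices"
    unfolding \<sigma>_def[abs_def] using bij_betw_label by (rule permutes_bij_inv_into)
  have \<sigma>_label: "\<sigma> (label v) = label (s v)" for v
    by (simp add: \<sigma>_def inj_on_def inv_f_f)
  define \<tau> where "\<tau> e = (if e \<in> K5_edges then \<sigma> ` e else e)" for e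
  have \<tau>_edge: "\<tau> (edge v w) = edge (s v) (s w)" if "v \<noteq> w" for v w
    using that by (simp add: \<tau>_def edge_in_K5 \<sigma>_label)
  have "\<tau> permutes K5_edges"
  proof (rule bij_imp_permutes)
    have inj: "inj_on \<tau> K5_edges"
      using permutes_inj[OF \<sigma>] by (auto simp: inj_on_def \<tau>_def inj_image_eq_iff)
    have "\<tau> ` K5_edges \<subseteq> K5_edges"
    proof (rule image_subsetI)
      fix e assume "e \<in> K5_edges"
      then obtain v w where "v \<noteq> w" "e = edge v w" by (rule K5_edgesE)
      then show "\<tau> e \<in> K5_edges" using edge_in_K5[of "s v" "s w"] s_inj by (simp add: \<tau>_edge)
    qed
    moreover have "finite K5_edges" using card_K5(2) card.infinite by fastforce
    ultimately show "bij_betw \<tau> K5_edges K5_edges"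
      using inj endo_inj_surj[of K5_edges \<tau>] by (simp add: bij_betw_def)
  qed (simp add: \<tau>_def)
  moreover have "n \<in> e \<longleftrightarrow> \<sigma> n \<in> \<tau> e" if "e \<in> K5_edges" for n e
    using that permutes_inj[OF \<sigma>] by (simp add: \<tau>_def inj_image_mem_iff)
  moreover have "\<rho>' (\<sigma> n) (\<tau> e) = \<tau> (\<rho> n e)"
    if n: "n \<in> K5_vertices" and e: "e \<in> incident_edges K5_edges n" for n e
  proof -
    obtain v where v: "n = label v" using n by (rule K5_verticesE)
    obtain w where w: "w \<noteq> v" "e = edge v w" using e unfolding v by (rule incident_edgesE)
    have "R v w \<noteq> v" using rotation_neq[OF coded_rotation[OF assms(1)] w(1)] .
    then have "\<tau> (edge v (R v w)) = edge (s v) (s (R v w))" by (intro \<tau>_edge) simp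
    then show ?thesis
      using coded_edge[OF assms(1), of v w] coded_edge[OF assms(2), of "s v" "s w"] w s_inj
      by (simp add: v \<sigma>_label \<tau>_edge s)
  qed
  ultimately show "isomorphic_embeddings K5_vertices K5_edges \<rho> \<rho>'"
    unfolding isomorphic_embeddings_def using \<sigma> by blast
qed

section \<open>Equivalence classes of embeddings\<close>

lemma embedding_equivalence_iff:
  assumes "coded \<rho> R" "coded \<rho>' R'"
  shows "(\<rho>, \<rho>') \<in> embedding_equivalence 2 K5_vertices K5_edges \<longleftrightarrow>
    face_count R = 3 \<and> face_count R' = 3 \<and> related R R'"
  using assms
  by (simp add: embedding_equivalence_def related_def double_torus_iff[OF assms(1)]
      double_torus_iff[OF assms(2)] isomorphic_embeddings_iff[OF assms]
      isomorphic_embeddings_iff[OF coded_reversal[OF assms(1)] assms(2)])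

lemma face_count_related:
  assumes "related R R'" "rotation R"
  shows "face_count R' = face_count R"
  using assms face_count_iso face_count_mirror rotation_mirror unfolding related_def by metis

lemma double_torus_coded:
  assumes "\<rho> \<in> double_torus_embeddings K5_vertices K5_edges"
  obtains R where "coded \<rho> R" "face_count R = 3"
proof -
  have "rotation_system K5_vertices K5_edges \<rho>" using assms by (simp add: two_cell_embeddings_def)
  then obtain R where "coded \<rho> R" using ex_coded_rotation by blast
  then show ?thesis using that assms double_torus_iff by blast
qed

lemma equivalence_coded:
  assumes "(\<rho>, \<rho>') \<in> embedding_equivalence 2 K5_vertices K5_edges"
  obtains R R' where "coded \<rho> R" "coded \<rho>' R'" "face_count R = 3" "face_count R' = 3" "related R R'"
proof -
  have "\<rho> \<in> double_torus_embeddings K5_vertices K5_edges" "\<rho>' \<in> double_torus_embeddings K5_vertices K5_edges"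
    using assms by (auto simp: embedding_equivalence_def)
  then obtain R R' where "coded \<rho> R" "coded \<rho>' R'" by (metis double_torus_coded)
  then show ?thesis using that assms embedding_equivalence_iff by blast
qed

lemma sym_embedding_equivalence: "sym (embedding_equivalence 2 K5_vertices K5_edges)"
proof (rule symI)
  fix \<rho> \<rho>' assume "(\<rho>, \<rho>') \<in> embedding_equivalence 2 K5_vertices K5_edges"
  then obtain R R' where R: "coded \<rho> R" "coded \<rho>' R'" "face_count R = 3" "face_count R' = 3" "related R R'"
    by (rule equivalence_coded)
  then have "related R' R" using related_sym coded_rotation by blast
  then show "(\<rho>', \<rho>) \<in> embedding_equivalence 2 K5_vertices K5_edges"
    using embedding_equivalence_iff[OF R(2,1)] R(3,4) by blast
qed

lemma trans_embedding_equivalence: "trans (embedding_equivalence 2 K5_vertices K5_edges)"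
proof (rule transI)
  fix \<rho> \<rho>' \<rho>''
  assume 1: "(\<rho>, \<rho>') \<in> embedding_equivalence 2 K5_vertices K5_edges"
    and 2: "(\<rho>', \<rho>'') \<in> embedding_equivalence 2 K5_vertices K5_edges"
  from 1 obtain R R' where R: "coded \<rho> R" "coded \<rho>' R'" "face_count R = 3" "related R R'"
    by (rule equivalence_coded)
  have "\<rho>'' \<in> double_torus_embeddings K5_vertices K5_edges"
    using 2 by (simp add: embedding_equivalence_def)
  then obtain R'' where R'': "coded \<rho>'' R''" by (rule double_torus_coded)
  have "related R' R''" "face_count R'' = 3"
    using 2 embedding_equivalence_iff[OF R(2) R''] by auto
  moreover have "related R R''"
    using R(4) \<open>related R' R''\<close> coded_rotation[OF R(1)] coded_rotation[OF R(2)] coded_rotation[OF R'']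
    by (rule related_trans)
  ultimately show "(\<rho>, \<rho>'') \<in> embedding_equivalence 2 K5_vertices K5_edges"
    using embedding_equivalence_iff[OF R(1) R''] R(3) by blast
qed

lemma nonorientable_iff:
  assumes "coded \<rho> R"
  shows "nonorientable_embedding K5_vertices K5_edges \<rho> \<longleftrightarrow> (\<exists>\<sigma>. rotation_iso (mirror_rotation R) R \<sigma>)"
  unfolding nonorientable_embedding_def
  using coded_reversal[OF assms] assms by (rule isomorphic_embeddings_iff)

text \<open>Being isomorphic to the mirror image is constant on classes: an isomorphism from
  \<open>R\<close> to \<open>R'\<close> also joins their mirror images, so the chain from the mirror
  of \<open>R'\<close> to the mirror of \<open>R\<close>, to \<open>R\<close>, to \<open>R'\<close>
  closes.\<close>

lemma self_mirror_related:
  assumes "related R R'" "rotation R" "rotation R'"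
  shows "(\<exists>\<sigma>. rotation_iso (mirror_rotation R) R \<sigma>) \<longleftrightarrow> (\<exists>\<sigma>. rotation_iso (mirror_rotation R') R' \<sigma>)"
proof -
  have "\<exists>\<sigma>. rotation_iso (mirror_rotation R') R' \<sigma>"
    if rel: "related R R'" and R: "rotation R" "rotation R'"
      and \<sigma>: "rotation_iso (mirror_rotation R) R \<sigma>" for R R' \<sigma>
  proof -
    have m: "rotation (mirror_rotation R)" using R(1) by (rule rotation_mirror)
    \<comment> \<open>If the relation goes through the mirror of \<open>R\<close>, composition with
      the inverse of \<open>\<sigma>\<close> makes it start at \<open>R\<close>.\<close>
    obtain \<tau> where \<tau>: "rotation_iso R R' \<tau>"
      using rel rotation_iso_inv[OF \<sigma>] rotation_iso_comp unfolding related_def by blast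
    have "rotation_iso (mirror_rotation R') (mirror_rotation R) (inv \<tau>)"
      using \<tau> R by (intro rotation_iso_inv rotation_iso_mirror)
    with \<sigma> \<tau> show ?thesis using rotation_iso_comp by blast
  qed
  with assms related_sym show ?thesis by metis
qed

text \<open>The property is a parameter, so that one argument serves both counts. Its invariance
  under \<open>related\<close> ensures that the least code representing an embedding still has the
  property.\<close>

lemma card_embedding_classes:
  assumes P: "\<And>\<rho> R. coded \<rho> R \<Longrightarrow> P \<rho> \<longleftrightarrow> Q R"
    and Q: "\<And>R R'. related R R' \<Longrightarrow> rotation R \<Longrightarrow> rotation R' \<Longrightarrow> Q R \<longleftrightarrow> Q R'"
  shows "card ({\<rho> \<in> double_torus_embeddings K5_vertices K5_edges. P \<rho>}
      // embedding_equivalence 2 K5_vertices K5_edges) =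
    card {c \<in> codes. minimal c \<and> face_count (decode c) = 3 \<and> Q (decode c)}"
proof -
  \<comment> \<open>Choosing one embedding for each code turns the least codes into representatives
    of the classes.\<close>
  have "\<forall>c\<in>codes. \<exists>\<rho>. coded \<rho> (decode c)"
    using ex_coded_rotation_system rotation_decode by blast
  then obtain h where "\<forall>c\<in>codes. coded (h c) (decode c)"
    by (rule bchoice[THEN exE])
  then have h: "coded (h c) (decode c)" if "c \<in> codes" for c
    using that by blast
  show ?thesis
  proof (rule card_quotient_representatives[where h = h])
    fix c assume "c \<in> {c \<in> codes. minimal c \<and> face_count (decode c) = 3 \<and> Q (decode c)}"
    then show "h c \<in> {\<rho> \<in> double_torus_embeddings K5_vertices K5_edges. P \<rho>}"
      using h P double_torus_iff by blast
  next
    fix \<rho> assume \<rho>: "\<rho> \<in> {\<rho> \<in> double_torus_embeddings K5_vertices K5_edges. P \<rho>}"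
    then obtain R where R: "coded \<rho> R" "face_count R = 3" by (blast elim: double_torus_coded)
    then have rot: "rotation R" by (blast intro: coded_rotation)
    obtain c where c: "c \<in> codes" "related R (decode c)"
      using ex_code[OF rot] unfolding related_def by blast
    obtain m where m: "m \<in> codes" "minimal m" "related (decode c) (decode m)"
      using ex_minimal[OF c(1)] by blast
    have rel: "related R (decode m)"
      using c(2) m(3) rot rotation_decode[OF c(1)] rotation_decode[OF m(1)] by (rule related_trans)
    then have "face_count (decode m) = 3" using face_count_related rot R(2) by simp
    moreover have "Q (decode m)" using Q[OF rel rot rotation_decode[OF m(1)]] P[OF R(1)] \<rho> by blast
    moreover have "(\<rho>, h m) \<in> embedding_equivalence 2 K5_vertices K5_edges"
      using embedding_equivalence_iff[OF R(1) h[OF m(1)]] R(2) rel calculation(1) by blast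
    ultimately show "\<exists>m\<in>{c \<in> codes. minimal c \<and> face_count (decode c) = 3 \<and> Q (decode c)}.
        (\<rho>, h m) \<in> embedding_equivalence 2 K5_vertices K5_edges"
      using m by blast
  next
    fix c c'
    assume c: "c \<in> {c \<in> codes. minimal c \<and> face_count (decode c) = 3 \<and> Q (decode c)}"
      "c' \<in> {c \<in> codes. minimal c \<and> face_count (decode c) = 3 \<and> Q (decode c)}"
      and "(h c, h c') \<in> embedding_equivalence 2 K5_vertices K5_edges"
    then have "related (decode c) (decode c')" using embedding_equivalence_iff h by blast
    with c show "c = c'" using minimal_unique by blast
  qed (rule sym_embedding_equivalence trans_embedding_equivalence)+
qed

theorem theorem16:
  shows "card ({\<rho> \<in> double_torus_embeddings K5_vertices K5_edges.
                  orientable_embedding K5_vertices K5_edges \<rho>}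
               // embedding_equivalence 2 K5_vertices K5_edges) = 14 \<and>
         card ({\<rho> \<in> double_torus_embeddings K5_vertices K5_edges.
                  nonorientable_embedding K5_vertices K5_edges \<rho>}
               // embedding_equivalence 2 K5_vertices K5_edges) = 17"
proof
  let ?Q = "\<lambda>R. \<exists>\<sigma>. rotation_iso (mirror_rotation R) R \<sigma>"
  have "{c \<in> codes. minimal c \<and> face_count (decode c) = 3 \<and> \<not> ?Q (decode c)} =
      {c \<in> codes. minimal c \<and> face_count (decode c) = 3 \<and> \<not> self_mirror c}"
    using self_mirror_iff by blast
  moreover have "card ({\<rho> \<in> double_torus_embeddings K5_vertices K5_edges.
        orientable_embedding K5_vertices K5_edges \<rho>}
      // embedding_equivalence 2 K5_vertices K5_edges) =
    card {c \<in> codes. minimal c \<and> face_count (decode c) = 3 \<and> \<not> ?Q (decode c)}"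
    unfolding orientable_embedding_def
    using nonorientable_iff self_mirror_related by (intro card_embedding_classes) blast+
  ultimately show "card ({\<rho> \<in> double_torus_embeddings K5_vertices K5_edges.
        orientable_embedding K5_vertices K5_edges \<rho>}
      // embedding_equivalence 2 K5_vertices K5_edges) = 14"
    using card_minimal_codes(2) by simp
  have "{c \<in> codes. minimal c \<and> face_count (decode c) = 3 \<and> ?Q (decode c)} =
      {c \<in> codes. minimal c \<and> face_count (decode c) = 3 \<and> self_mirror c}"
    using self_mirror_iff by blast
  moreover have "card ({\<rho> \<in> double_torus_embeddings K5_vertices K5_edges.
        nonorientable_embedding K5_vertices K5_edges \<rho>}
      // embedding_equivalence 2 K5_vertices K5_edges) =
    card {c \<in> codes. minimal c \<and> face_count (decode c) = 3 \<and> ?Q (decode c)}"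
    using nonorientable_iff self_mirror_related by (intro card_embedding_classes) blast+
  ultimately show "card ({\<rho> \<in> double_torus_embeddings K5_vertices K5_edges.
        nonorientable_embedding K5_vertices K5_edges \<rho>}
      // embedding_equivalence 2 K5_vertices K5_edges) = 17"
    using card_minimal_codes(1) by simp
qed

end
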